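(* Let $\epsilon>0$ be a fixed constant, let $\delta>0$, and let $p=p(n)$ satisfy $n^{-1/3+\delta}\le p\le 1/2$. Let $b=1/(1-p)$. Then asymptotically almost surely the random graph $G_{n,p}$ has the following property: for every collection $E$ of $2^{-12}\epsilon^2\frac{n^2}{\log_b^2(np)}$ pairs of vertices (edges), the chromatic number of the graph $G_{n,p}\cup E$ is at most $(1+\epsilon)\frac{n}{2\log_b(np)}$.
   Context: $G_{n,p}$ is the random graph on the vertex set $\{1,\dots,n\}$ in which each pair of vertices is an edge independently with probability $p$. $G_{n,p}\cup E$ denotes the graph on the same vertex set whose edge set is the union of the edges of $G_{n,p}$ and $E$. "Asymptotically almost surely" means with probability tending to $1$ as $n\to\infty$. $\log_b x=\log x/\log b$, where $\log$ is the natural logarithm. *)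

theory Defs
  imports "HOL-Probability.Probability" "HOL-Library.Ramsey"
begin

text \<open>A graph on a vertex set \<open>V\<close> is represented by its edge set, a subset of
  \<open>nsets V 2\<close>, the set of all two-element subsets of \<open>V\<close>.\<close>

definition proper_colouring :: "'a set \<Rightarrow> 'a set set \<Rightarrow> nat \<Rightarrow> ('a \<Rightarrow> nat) \<Rightarrow> bool" where
  "proper_colouring V G k c \<longleftrightarrow>
     c \<in> V \<rightarrow> {..<k} \<and> (\<forall>u\<in>V. \<forall>v\<in>V. {u, v} \<in> G \<longrightarrow> c u \<noteq> c v)"

text \<open>Meaningful for finite \<open>V\<close>, where \<open>card V\<close> colours always suffice.\<close>

definition chromatic_number :: "'a set \<Rightarrow> 'a set set \<Rightarrow> nat" where
  "chromatic_number V G = (LEAST k. \<exists>c. proper_colouring V G k c)"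

definition random_graph :: "nat \<Rightarrow> real \<Rightarrow> nat set set pmf" where
  "random_graph n p =
     map_pmf (\<lambda>f. {e \<in> nsets {1..n} 2. f e})
       (Pi_pmf (nsets {1..n} 2) False (\<lambda>_. bernoulli_pmf p))"

end

theory Submission
  imports Defs "HOL-Real_Asymp.Real_Asymp"
begin

text \<open>
  Write \<open>\<Lambda> = log\<^sub>b(np)\<close> and let \<open>k\<close> be slightly below \<open>2\<Lambda>\<close>. For a family \<open>K\<close> of \<open>k\<close>-subsets of a
  vertex set \<open>S\<close> consider the fractional number of pairs needed to hit every member of \<open>K\<close> that is
  independent in the random graph. It changes by at most one when a single edge is flipped, and if
  \<open>K\<close> contains half of all \<open>k\<close>-subsets, then a second moment computation for the number of
  independent sets through a given pair shows that its mean is of order \<open>|S|\<^sup>2/k\<^sup>2\<close>. As edges have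
  probability \<open>p\<close>, it falls below a smaller constant multiple of that with probability at most
  \<open>exp(-c|S|\<^sup>2/(k\<^sup>4 p))\<close>, which for \<open>p \<ge> n\<^bsup>-1/3+\<delta>\<^esup>\<close> beats a union bound over all large \<open>S\<close> and all
  families \<open>K\<close> given by a lower bound on a sum of vertex weights in \<open>{0..n}\<close>. Hence almost surely
  every large \<open>S\<close> contains, for every \<open>E\<close>, an independent \<open>k\<close>-set spanning \<open>O(k\<^sup>2/|S|\<^sup>2)\<close> of the
  \<open>E\<close>-edges in \<open>S\<close> and having at least its fair share (up to a constant) of a prescribed vertex
  weight.

  Given \<open>E\<close>, first give the vertices of large \<open>E\<close>-degree private colours. Then remove such
  \<open>k\<close>-sets greedily, taking the \<open>E\<close>-degree as weight, and colour each of them according to the few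
  \<open>E\<close>-edges inside. The choice of weight forces the number of remaining \<open>E\<close>-edges to decrease
  linearly with the number of remaining vertices, so that the extra cost is a convergent sum of
  order \<open>\<surd>|E|\<close> without a logarithmic loss. When only \<open>n/ln\<^sup>2 n\<close> vertices are left, the union of
  both graphs is degenerate enough to be coloured greedily.
\<close>

section \<open>Lipschitz functions of random subsets\<close>

definition random_subset :: "'a set \<Rightarrow> real \<Rightarrow> 'a set pmf" where
  "random_subset A p =
     map_pmf (\<lambda>f. {x \<in> A. f x}) (Pi_pmf A False (\<lambda>_. bernoulli_pmf p))"

lemma random_graph_eq_random_subset: "random_graph n p = random_subset (nsets {1..n} 2) p"
  by (simp add: random_graph_def random_subset_def)

lemma random_subset_subset: "G \<in> set_pmf (random_subset A p) \<Longrightarrow> G \<subseteq> A"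
  by (auto simp: random_subset_def)

lemma finite_set_pmf_random_subset [simp]: "finite A \<Longrightarrow> finite (set_pmf (random_subset A p))"
  by (rule finite_subset[of _ "Pow A"]) (auto dest: random_subset_subset)

lemma integrable_random_subset [simp]:
  fixes f :: "'a set \<Rightarrow> real"
  shows "finite A \<Longrightarrow> integrable (measure_pmf (random_subset A p)) f"
  by (simp add: integrable_measure_pmf_finite)

lemma random_subset_empty [simp]: "random_subset {} p = return_pmf {}"
  by (simp add: random_subset_def)

lemma random_subset_insert:
  assumes "finite A" "x \<notin> A"
  shows "random_subset (insert x A) p =
    bernoulli_pmf p \<bind> (\<lambda>b. map_pmf (\<lambda>G. if b then insert x G else G) (random_subset A p))"
proof -
  have "{z \<in> insert x A. (f(x := b)) z} = (if b then insert x {z \<in> A. f z} else {z \<in> A. f z})"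
    for f b
    using assms by auto
  then show ?thesis
    using assms
    by (simp add: random_subset_def Pi_pmf_insert' map_bind_pmf map_pmf_def bind_assoc_pmf
        bind_return_pmf)
qed

lemma expectation_random_subset_insert:
  fixes f :: "'a set \<Rightarrow> real"
  assumes "finite A" "x \<notin> A" "0 \<le> p" "p \<le> 1"
  shows "measure_pmf.expectation (random_subset (insert x A) p) f =
    measure_pmf.expectation (random_subset A p) (\<lambda>G. p * f (insert x G) + (1 - p) * f G)"
proof -
  have "measure_pmf.expectation (random_subset (insert x A) p) f =
    (\<Sum>b\<in>UNIV. pmf (bernoulli_pmf p) b *\<^sub>R measure_pmf.expectation
      (map_pmf (\<lambda>G. if b then insert x G else G) (random_subset A p)) f)"
    unfolding random_subset_insert[OF assms(1,2)]
    by (rule pmf_expectation_bind) (use assms in auto)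
  then show ?thesis
    using assms by (simp add: UNIV_bool)
qed

lemma exp_le_quadratic:
  fixes t :: real
  assumes "\<bar>t\<bar> \<le> 1"
  shows "exp t \<le> 1 + t + t\<^sup>2"
proof (cases "t \<ge> 0")
  case True
  then show ?thesis
    using assms exp_bound[of t] by simp
next
  case False
  then have pos: "1 - t + t\<^sup>2 / 2 > 0"
    by (simp add: add_pos_nonneg)
  have "1 - t + t\<^sup>2 / 2 \<le> exp (- t)"
    using exp_lower_Taylor_quadratic[of "- t"] False by simp
  then have "exp t \<le> 1 / (1 - t + t\<^sup>2 / 2)"
    using pos by (simp add: exp_minus field_simps)
  also have "1 \<le> (1 + t + t\<^sup>2) * (1 - t + t\<^sup>2 / 2)"
  proof -
    have "(1 + t + t\<^sup>2) * (1 - t + t\<^sup>2 / 2) = 1 + t\<^sup>2 / 2 * (1 - t + t\<^sup>2)"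
      by (simp add: power2_eq_square field_simps)
    moreover have "0 \<le> t\<^sup>2 / 2 * (1 - t + t\<^sup>2)"
      using False by (intro mult_nonneg_nonneg) auto
    ultimately show ?thesis
      by linarith
  qed
  then have "1 / (1 - t + t\<^sup>2 / 2) \<le> 1 + t + t\<^sup>2"
    using pos by (simp add: divide_le_eq)
  finally show ?thesis .
qed

lemma two_point_mgf:
  fixes p u v l c z :: real
  assumes p: "0 \<le> p" "p \<le> 1" and l: "0 \<le> l" "l \<le> 1" and uv: "\<bar>u - v\<bar> \<le> c" and c: "c \<le> 1"
  defines "m \<equiv> p * u + (1 - p) * v"
  shows "p * exp (l * (z - u)) + (1 - p) * exp (l * (z - v))
    \<le> exp (l * (z - m)) * exp (p * l\<^sup>2 * c\<^sup>2)"
proof -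
  define t where "t = l * (v - u)"
  have abs_t: "\<bar>t\<bar> \<le> l * c"
    unfolding t_def abs_mult using l uv by (intro mult_mono) auto
  also have "\<dots> \<le> 1 * 1"
    using l c uv by (intro mult_mono) auto
  finally have quad: "exp t \<le> 1 + t + t\<^sup>2"
    by (intro exp_le_quadratic) simp
  have "p * exp (l * (z - u)) + (1 - p) * exp (l * (z - v)) =
      exp (l * (z - m)) * (exp (- p * t) * (1 + p * (exp t - 1)))"
  proof -
    have "l * (z - u) = l * (z - m) + (- p * t + t)" "l * (z - v) = l * (z - m) + - p * t"
      by (simp_all add: m_def t_def algebra_simps)
    then show ?thesis
      by (simp only: exp_add) (simp add: algebra_simps)
  qed
  also have "exp (- p * t) * (1 + p * (exp t - 1)) \<le> exp (- p * t) * exp (p * (exp t - 1))"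
    by (intro mult_left_mono exp_ge_add_one_self) simp
  also have "\<dots> = exp (p * (exp t - 1 - t))"
    by (simp add: exp_add[symmetric] algebra_simps)
  also have "\<dots> \<le> exp (p * (l\<^sup>2 * c\<^sup>2))"
    using quad power_mono[OF abs_t, of 2] p by (simp add: power_mult_distrib mult_left_mono)
  finally show ?thesis
    by (simp add: mult.assoc)
qed

lemma abs_diff_average_le:
  fixes p c u v u' v' :: real
  assumes "0 \<le> p" "p \<le> 1" "\<bar>u' - u\<bar> \<le> c" "\<bar>v' - v\<bar> \<le> c"
  shows "\<bar>(p * u' + (1 - p) * v') - (p * u + (1 - p) * v)\<bar> \<le> c"
proof -
  have "\<bar>(p * u' + (1 - p) * v') - (p * u + (1 - p) * v)\<bar> = \<bar>p * (u' - u) + (1 - p) * (v' - v)\<bar>"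
    by (simp add: algebra_simps)
  also have "\<dots> \<le> p * c + (1 - p) * c"
    using assms
    by (intro order_trans[OF abs_triangle_ineq] add_mono)
      (auto simp: abs_mult intro!: mult_left_mono)
  finally show ?thesis
    by (simp add: algebra_simps)
qed

lemma expectation_exp_lipschitz:
  fixes f :: "'a set \<Rightarrow> real" and c :: "'a \<Rightarrow> real"
  assumes "finite A" and p: "0 \<le> p" "p \<le> 1" and l: "0 \<le> l" "l \<le> 1"
    and "\<And>G x. x \<in> A \<Longrightarrow> \<bar>f (insert x G) - f G\<bar> \<le> c x" and "\<And>x. x \<in> A \<Longrightarrow> c x \<le> 1"
  shows "measure_pmf.expectation (random_subset A p)
      (\<lambda>G. exp (l * (measure_pmf.expectation (random_subset A p) f - f G)))
    \<le> exp (p * l\<^sup>2 * (\<Sum>x\<in>A. (c x)\<^sup>2))"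
  using assms(1,6,7)
proof (induction A arbitrary: f rule: finite_induct)
  case empty
  then show ?case by simp
next
  case (insert x A)
  define h where "h = (\<lambda>G. p * f (insert x G) + (1 - p) * f G)"
  let ?E = "measure_pmf.expectation (random_subset A p)"
  have mean: "measure_pmf.expectation (random_subset (insert x A) p) f = ?E h"
    unfolding h_def using insert.hyps p by (rule expectation_random_subset_insert)
  have h_lipschitz: "\<bar>h (insert y G) - h G\<bar> \<le> c y" if "y \<in> A" for y G
    unfolding h_def insert_commute[of x y] using insert.prems(1) that p
    by (intro abs_diff_average_le) auto
  have "measure_pmf.expectation (random_subset (insert x A) p) (\<lambda>G. exp (l * (?E h - f G))) =
      ?E (\<lambda>G. p * exp (l * (?E h - f (insert x G))) + (1 - p) * exp (l * (?E h - f G)))"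
    using insert.hyps p by (rule expectation_random_subset_insert)
  also have "\<dots> \<le> ?E (\<lambda>G. exp (l * (?E h - h G)) * exp (p * l\<^sup>2 * (c x)\<^sup>2))"
  proof (rule integral_mono)
    show "p * exp (l * (?E h - f (insert x G))) + (1 - p) * exp (l * (?E h - f G))
       \<le> exp (l * (?E h - h G)) * exp (p * l\<^sup>2 * (c x)\<^sup>2)" for G
      unfolding h_def using insert.prems by (intro two_point_mgf p l) auto
  qed (use insert.hyps in auto)
  also have "\<dots> = ?E (\<lambda>G. exp (l * (?E h - h G))) * exp (p * l\<^sup>2 * (c x)\<^sup>2)"
    by simp
  also have "\<dots> \<le> exp (p * l\<^sup>2 * (\<Sum>y\<in>A. (c y)\<^sup>2)) * exp (p * l\<^sup>2 * (c x)\<^sup>2)"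
    by (intro mult_right_mono insert.IH h_lipschitz insert.prems) auto
  also have "\<dots> = exp (p * l\<^sup>2 * (\<Sum>y\<in>insert x A. (c y)\<^sup>2))"
    using insert.hyps by (simp add: exp_add[symmetric] algebra_simps)
  finally show ?case
    unfolding mean .
qed

lemma lipschitz_lower_tail:
  fixes f :: "'a set \<Rightarrow> real" and c :: "'a \<Rightarrow> real"
  assumes "finite A" and "0 \<le> p" "p \<le> 1" and "0 \<le> l" "l \<le> 1"
    and "\<And>G x. x \<in> A \<Longrightarrow> \<bar>f (insert x G) - f G\<bar> \<le> c x" and "\<And>x. x \<in> A \<Longrightarrow> c x \<le> 1"
  shows "measure_pmf.prob (random_subset A p)
      {G. f G \<le> measure_pmf.expectation (random_subset A p) f - t}
    \<le> exp (p * l\<^sup>2 * (\<Sum>x\<in>A. (c x)\<^sup>2) - l * t)"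
proof -
  let ?M = "random_subset A p"
  let ?E = "measure_pmf.expectation ?M f"
  have "measure_pmf.prob ?M {G. f G \<le> ?E - t} \<le>
      measure_pmf.prob ?M {G. exp (l * t) \<le> exp (l * (?E - f G))}"
    using assms(4) by (intro measure_pmf.finite_measure_mono) (auto intro!: mult_left_mono)
  also have "\<dots> \<le> measure_pmf.expectation ?M (\<lambda>G. exp (l * (?E - f G))) / exp (l * t)"
    using assms(1)
      integral_Markov_inequality_measure[of ?M "\<lambda>G. exp (l * (?E - f G))" "{}" "exp (l * t)"]
    by simp
  also have "\<dots> \<le> exp (p * l\<^sup>2 * (\<Sum>x\<in>A. (c x)\<^sup>2)) / exp (l * t)"
    by (intro divide_right_mono expectation_exp_lipschitz assms) auto
  finally show ?thesis
    by (simp add: exp_diff)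
qed

lemma unit_lipschitz_lower_tail:
  fixes f :: "'a set \<Rightarrow> real"
  assumes "finite A" "F \<subseteq> A" and "0 \<le> p" "p \<le> 1" and "0 \<le> l" "l \<le> 1"
    and "\<And>G x. \<bar>f (insert x G) - f G\<bar> \<le> of_bool (x \<in> F)"
  shows "measure_pmf.prob (random_subset A p)
      {G. f G \<le> measure_pmf.expectation (random_subset A p) f - t}
    \<le> exp (p * l\<^sup>2 * card F - l * t)"
proof -
  have "(\<Sum>x\<in>A. (of_bool (x \<in> F) :: real)\<^sup>2) = card F"
    using assms(1,2) by (simp add: power2_eq_square Int_absorb1 flip: of_bool_conj)
  then show ?thesis
    using lipschitz_lower_tail[OF assms(1,3-6), of f "\<lambda>x. of_bool (x \<in> F)" t] assms(7) by simp
qed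

lemma expectation_disjoint:
  assumes "finite A" "F \<subseteq> A" "0 \<le> p" "p \<le> 1"
  shows "measure_pmf.expectation (random_subset A p) (\<lambda>G. of_bool (F \<inter> G = {})) = (1 - p) ^ card F"
  using assms(1,2)
proof (induction A arbitrary: F rule: finite_induct)
  case empty
  then show ?case by simp
next
  case (insert x A)
  let ?E = "measure_pmf.expectation (random_subset A p)"
  have fin: "finite F"
    using insert finite_subset by blast
  have split: "measure_pmf.expectation (random_subset (insert x A) p) (\<lambda>G. of_bool (F \<inter> G = {})) =
      ?E (\<lambda>G. p * of_bool (F \<inter> insert x G = {}) + (1 - p) * of_bool (F \<inter> G = {}))"
    using insert.hyps assms(3,4) by (rule expectation_random_subset_insert)
  show ?case
  proof (cases "x \<in> F")
    case True
    then obtain F' where F': "F = insert x F'" "x \<notin> F'"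
      by (rule Set.set_insert)
    have "?E (\<lambda>G. of_bool (F \<inter> G = {})) = ?E (\<lambda>G. of_bool (F' \<inter> G = {}))"
      unfolding F' using insert.hyps
      by (intro integral_cong_AE) (auto simp: AE_measure_pmf_iff dest: random_subset_subset)
    also have "\<dots> = (1 - p) ^ card F'"
      using insert.prems F' by (intro insert.IH) auto
    finally show ?thesis
      unfolding split using F' fin by simp
  next
    case False
    then show ?thesis
      unfolding split using insert.IH[of F] insert.prems by (simp add: subset_insert algebra_simps)
  qed
qed

lemma expectation_mem:
  assumes "finite A" "x \<in> A" "0 \<le> p" "p \<le> 1"
  shows "measure_pmf.expectation (random_subset A p) (\<lambda>G. of_bool (x \<in> G)) = p"
proof -
  have "measure_pmf.expectation (random_subset A p) (\<lambda>G. 1 - of_bool (x \<in> G)) = 1 - p"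
    using expectation_disjoint[of A "{x}" p] assms by (simp add: of_bool_not_iff)
  then show ?thesis
    using assms(1) by simp
qed

lemma card_Int_upper_tail:
  fixes t :: real
  assumes "finite A" "F \<subseteq> A" "0 \<le> p" "p \<le> 1"
  shows "measure_pmf.prob (random_subset A p) {G. t \<le> card (F \<inter> G)} \<le> exp (2 * p * card F - t)"
proof -
  define f where "f = (\<lambda>G. - (\<Sum>x\<in>F. of_bool (x \<in> G) :: real))"
  have fin: "finite F"
    using assms finite_subset by blast
  have card_eq: "real (card (F \<inter> G)) = - f G" for G
    using fin by (simp add: f_def)
  have mean: "measure_pmf.expectation (random_subset A p) f = - (p * card F)"
    using assms expectation_mem[OF assms(1) _ assms(3,4)]
    by (simp add: f_def Bochner_Integration.integral_sum subset_iff mult.commute)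
  have lipschitz: "\<bar>f (insert x G) - f G\<bar> \<le> of_bool (x \<in> F)" for x G
  proof -
    have "f G - f (insert x G) = (\<Sum>y\<in>F. of_bool (y = x \<and> x \<notin> G))"
      unfolding f_def by (simp add: sum_subtractf[symmetric]) (intro sum.cong, auto)
    also have "\<dots> = of_bool (x \<in> F \<and> x \<notin> G)"
      using fin by (cases "x \<in> G") auto
    finally show ?thesis
      by (simp add: abs_minus_commute[of "f (insert x G)"])
  qed
  have "measure_pmf.prob (random_subset A p) {G. t \<le> card (F \<inter> G)} =
      measure_pmf.prob (random_subset A p)
        {G. f G \<le> measure_pmf.expectation (random_subset A p) f - (t - p * card F)}"
    unfolding mean card_eq by (simp add: minus_le_iff le_minus_iff)
  also have "\<dots> \<le> exp (p * 1\<^sup>2 * card F - 1 * (t - p * card F))"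
    by (intro unit_lipschitz_lower_tail assms lipschitz) auto
  finally show ?thesis
    by (simp add: algebra_simps)
qed

section \<open>Subsets of a fixed size\<close>

lemma real_choose_two: "real (n choose 2) = real n * (real n - 1) / 2"
  by (induction n) (auto simp: numeral_2_eq_2 algebra_simps)

lemma choose_two_pos: "2 \<le> n \<Longrightarrow> 1 \<le> n choose 2"
  using zero_less_binomial[of 2 n] by linarith

lemma binomial_minus1_eq:
  assumes "0 < k" "k \<le> n"
  shows "real ((n - 1) choose (k - 1)) = real k / real n * real (n choose k)"
proof -
  have "real k * real (n choose k) = real n * real ((n - 1) choose (k - 1))"
    unfolding of_nat_mult[symmetric] using assms by (simp add: times_binomial_minus1_eq)
  then show ?thesis
    using assms by (simp add: field_simps)
qed

lemma binomial_diff_le: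
  assumes "j \<le> k" "k \<le> n"
  shows "real ((n - j) choose (k - j)) \<le> (real k / real n) ^ j * real (n choose k)"
  using assms
proof (induction j)
  case 0
  then show ?case by simp
next
  case (Suc j)
  have "real (n - j - 1 choose (k - j - 1)) =
      real (k - j) / real (n - j) * real (n - j choose (k - j))"
    using Suc.prems by (intro binomial_minus1_eq) auto
  also have "\<dots> \<le> real k / real n * ((real k / real n) ^ j * real (n choose k))"
  proof (intro mult_mono Suc.IH)
    have "real j * real k \<le> real j * real n"
      using Suc.prems by (intro mult_left_mono) auto
    then show "real (k - j) / real (n - j) \<le> real k / real n"
      using Suc.prems by (simp add: of_nat_diff divide_simps) (simp add: algebra_simps)
  qed (use Suc.prems in auto)
  finally show ?case
    by simp
qed

definition nsets_above :: "'a set \<Rightarrow> nat \<Rightarrow> 'a set \<Rightarrow> 'a set set" where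
  "nsets_above S k T = {J \<in> nsets S k. T \<subseteq> J}"

lemma nsets_above_subset: "nsets_above S k T \<subseteq> nsets S k"
  by (auto simp: nsets_above_def)

lemma finite_nsets_above [simp]: "finite S \<Longrightarrow> finite (nsets_above S k T)"
  by (rule finite_subset[OF nsets_above_subset finite_imp_finite_nsets])

lemma nsets_aboveD:
  assumes "I \<in> nsets_above S k T"
  shows "I \<subseteq> S" "finite I" "card I = k" "T \<subseteq> I"
  using assms by (auto simp: nsets_above_def nsets_def)

lemma card_nsets_above:
  assumes "finite S" "T \<subseteq> S" "card T \<le> k"
  shows "card (nsets_above S k T) = (card S - card T) choose (k - card T)"
proof -
  have fin: "finite T"
    using assms finite_subset by blast
  have "bij_betw (\<lambda>B. B \<union> T) (nsets (S - T) (k - card T)) (nsets_above S k T)"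
  proof (rule bij_betw_byWitness[where f' = "\<lambda>J. J - T"])
    show "(\<lambda>B. B \<union> T) ` nsets (S - T) (k - card T) \<subseteq> nsets_above S k T"
    proof clarify
      fix B assume B: "B \<in> nsets (S - T) (k - card T)"
      then have "card (B \<union> T) = k"
        using assms fin by (subst card_Un_disjoint) (auto simp: nsets_def)
      then show "B \<union> T \<in> nsets_above S k T"
        using B assms fin by (auto simp: nsets_def nsets_above_def)
    qed
    show "(\<lambda>J. J - T) ` nsets_above S k T \<subseteq> nsets (S - T) (k - card T)"
      using fin by (auto simp: nsets_def nsets_above_def card_Diff_subset)
  qed (auto simp: nsets_def nsets_above_def)
  from bij_betw_same_card[OF this] show ?thesis
    using assms fin by (simp add: card_Diff_subset)
qed

lemma card_nsets_above_le:
  assumes "finite S" "T \<subseteq> S" "card T \<le> k" "k \<le> card S"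
  shows "real (card (nsets_above S k T)) \<le>
    (real k / real (card S)) ^ card T * real (card S choose k)"
  unfolding card_nsets_above[OF assms(1-3)] using assms(3,4) by (rule binomial_diff_le)

lemma card_nsets_above_singleton:
  assumes "finite S" "v \<in> S" "0 < k" "k \<le> card S"
  shows "real (card (nsets_above S k {v})) = real k / real (card S) * real (card S choose k)"
  using card_nsets_above[of S "{v}" k] binomial_minus1_eq[OF assms(3,4)] assms by simp

lemma sum_nsets_sum:
  fixes x :: "'a \<Rightarrow> real"
  assumes S: "finite S" and k: "0 < k" "k \<le> card S"
  shows "(\<Sum>I\<in>nsets S k. sum x I) = real k / real (card S) * real (card S choose k) * sum x S"
proof -
  have "(\<Sum>I\<in>nsets S k. sum x I) = (\<Sum>I\<in>nsets S k. sum x {v \<in> S. v \<in> I})"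
    by (intro sum.cong arg_cong[where f = "sum x"]) (auto simp: nsets_def)
  also have "\<dots> = (\<Sum>v\<in>S. \<Sum>I | I \<in> nsets S k \<and> v \<in> I. x v)"
    using S by (intro sum.swap_restrict finite_imp_finite_nsets)
  also have "\<dots> = (\<Sum>v\<in>S. real (card (nsets_above S k {v})) * x v)"
    by (simp add: nsets_above_def)
  also have "\<dots> = real k / real (card S) * real (card S choose k) * sum x S"
    unfolding sum_distrib_left by (rule sum.cong) (simp_all add: card_nsets_above_singleton S k)
  finally show ?thesis .
qed

lemma sum_nsets_sum_squared:
  fixes x :: "'a \<Rightarrow> real"
  assumes S: "finite S"
  shows "(\<Sum>I\<in>nsets S k. (sum x I)\<^sup>2) =
    (\<Sum>(u, v)\<in>S \<times> S. real (card (nsets_above S k {u, v})) * (x u * x v))"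
proof -
  have "(\<Sum>I\<in>nsets S k. (sum x I)\<^sup>2) =
      (\<Sum>I\<in>nsets S k. \<Sum>q | q \<in> S \<times> S \<and> {fst q, snd q} \<subseteq> I. x (fst q) * x (snd q))"
  proof (rule sum.cong[OF refl])
    fix I assume "I \<in> nsets S k"
    then have "I \<times> I = {q \<in> S \<times> S. {fst q, snd q} \<subseteq> I}"
      by (auto simp: nsets_def)
    then show "(sum x I)\<^sup>2 = (\<Sum>q | q \<in> S \<times> S \<and> {fst q, snd q} \<subseteq> I. x (fst q) * x (snd q))"
      by (simp add: power2_eq_square sum_product sum.cartesian_product case_prod_unfold)
  qed
  also have "\<dots> = (\<Sum>q\<in>S \<times> S. \<Sum>I | I \<in> nsets S k \<and> {fst q, snd q} \<subseteq> I. x (fst q) * x (snd q))"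
    using S by (intro sum.swap_restrict finite_imp_finite_nsets finite_cartesian_product)
  finally show ?thesis
    by (simp add: case_prod_unfold nsets_above_def)
qed

lemma sum_nsets_sum_squared_le:
  fixes x :: "'a \<Rightarrow> real"
  assumes S: "finite S" and k: "2 \<le> k" "k \<le> card S" and x: "\<And>v. v \<in> S \<Longrightarrow> 0 \<le> x v"
  defines "r \<equiv> real k / real (card S)" and "C \<equiv> real (card S choose k)"
  shows "(\<Sum>I\<in>nsets S k. (sum x I)\<^sup>2) \<le> r * C * (\<Sum>v\<in>S. (x v)\<^sup>2) + r\<^sup>2 * C * (sum x S)\<^sup>2"
proof -
  have "(\<Sum>I\<in>nsets S k. (sum x I)\<^sup>2) \<le>
      (\<Sum>(u, v)\<in>S \<times> S. (if u = v then r * C * (x u)\<^sup>2 else 0) + r\<^sup>2 * C * (x u * x v))"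
    unfolding sum_nsets_sum_squared[OF S]
  proof (rule sum_mono, clarify)
    fix u v assume uv: "u \<in> S" "v \<in> S"
    then have nonneg: "0 \<le> x u * x v"
      by (simp add: x)
    show "real (card (nsets_above S k {u, v})) * (x u * x v) \<le>
        (if u = v then r * C * (x u)\<^sup>2 else 0) + r\<^sup>2 * C * (x u * x v)"
    proof (cases "u = v")
      case True
      then show ?thesis
        using card_nsets_above_singleton[OF S uv(1), of k] k nonneg
        by (simp add: r_def C_def power2_eq_square)
    next
      case False
      then have "real (card (nsets_above S k {u, v})) \<le> r\<^sup>2 * C"
        using card_nsets_above_le[OF S, of "{u, v}" k] uv k
        by (simp add: r_def C_def power2_eq_square)
      from mult_right_mono[OF this nonneg] show ?thesis
        using False by (simp add: mult.assoc)
    qed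
  qed
  also have "\<dots> = r * C * (\<Sum>v\<in>S. (x v)\<^sup>2) + r\<^sup>2 * C * (\<Sum>u\<in>S. \<Sum>v\<in>S. x u * x v)"
    using S by (simp add: sum.cartesian_product[symmetric] sum.distrib sum_distrib_left)
  also have "(\<Sum>u\<in>S. \<Sum>v\<in>S. x u * x v) = (sum x S)\<^sup>2"
    unfolding power2_eq_square sum_product ..
  finally show ?thesis .
qed

lemma sum_nsets_deviation_squared_le:
  fixes x :: "'a \<Rightarrow> real"
  assumes S: "finite S" and k: "2 \<le> k" "k \<le> card S" and x: "\<And>v. v \<in> S \<Longrightarrow> 0 \<le> x v"
  defines "r \<equiv> real k / real (card S)" and "C \<equiv> real (card S choose k)"
  shows "(\<Sum>I\<in>nsets S k. (sum x I - r * sum x S)\<^sup>2) \<le> r * C * (\<Sum>v\<in>S. (x v)\<^sup>2)"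
proof -
  define m where "m = r * sum x S"
  have "(\<Sum>I\<in>nsets S k. (sum x I - m)\<^sup>2) =
      (\<Sum>I\<in>nsets S k. (sum x I)\<^sup>2) - 2 * m * (\<Sum>I\<in>nsets S k. sum x I) + C * m\<^sup>2"
    by (simp add: power2_diff sum.distrib sum_subtractf sum_distrib_left C_def mult_ac)
  also have "(\<Sum>I\<in>nsets S k. sum x I) = C * m"
    using sum_nsets_sum[OF S, of k x] k by (simp add: m_def r_def C_def)
  also have "(\<Sum>I\<in>nsets S k. (sum x I)\<^sup>2) \<le> r * C * (\<Sum>v\<in>S. (x v)\<^sup>2) + C * m\<^sup>2"
    using sum_nsets_sum_squared_le[OF S k, of x] x
    by (simp add: m_def r_def C_def power_mult_distrib power_divide mult_ac)
  finally show ?thesis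
    unfolding m_def[symmetric] by (simp add: power2_eq_square)
qed

definition heavy_sets :: "'a set \<Rightarrow> nat \<Rightarrow> ('a \<Rightarrow> real) \<Rightarrow> 'a set set" where
  "heavy_sets S k x = {I \<in> nsets S k. 3 / 5 * (real k / real (card S) * sum x S) \<le> sum x I}"

lemma heavy_sets_subset: "heavy_sets S k x \<subseteq> nsets S k"
  by (auto simp: heavy_sets_def)

lemma card_light_nsets_le:
  fixes x :: "'a \<Rightarrow> real"
  assumes S: "finite S" and k: "2 \<le> k" "k \<le> card S" and x: "\<And>v. v \<in> S \<Longrightarrow> 0 \<le> x v"
  defines "m \<equiv> real k / real (card S) * sum x S"
  shows "real (card (nsets S k - heavy_sets S k x)) * (2 / 5 * m)\<^sup>2 \<le>
    real k / real (card S) * real (card S choose k) * (\<Sum>v\<in>S. (x v)\<^sup>2)"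
proof -
  let ?L = "nsets S k - heavy_sets S k x"
  have m: "0 \<le> m"
    unfolding m_def using x by (intro mult_nonneg_nonneg sum_nonneg) auto
  have "real (card ?L) * (2 / 5 * m)\<^sup>2 = (\<Sum>I\<in>?L. (2 / 5 * m)\<^sup>2)"
    by simp
  also have "\<dots> \<le> (\<Sum>I\<in>?L. (sum x I - m)\<^sup>2)"
  proof (rule sum_mono)
    fix I assume "I \<in> ?L"
    then have "sum x I < 3 / 5 * m"
      by (auto simp: heavy_sets_def m_def)
    then have "(2 / 5 * m)\<^sup>2 \<le> (m - sum x I)\<^sup>2"
      using m by (intro power_mono) auto
    then show "(2 / 5 * m)\<^sup>2 \<le> (sum x I - m)\<^sup>2"
      by (simp add: power2_commute)
  qed
  also have "\<dots> \<le> (\<Sum>I\<in>nsets S k. (sum x I - m)\<^sup>2)"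
    using finite_imp_finite_nsets[OF S] by (intro sum_mono2) auto
  also have "\<dots> \<le> real k / real (card S) * real (card S choose k) * (\<Sum>v\<in>S. (x v)\<^sup>2)"
    unfolding m_def by (rule sum_nsets_deviation_squared_le[OF S k x])
  finally show ?thesis .
qed

lemma heavy_sets_dense:
  fixes x :: "'a \<Rightarrow> real"
  assumes S: "finite S" and k: "2 \<le> k" "k \<le> card S"
    and x: "\<And>v. v \<in> S \<Longrightarrow> 0 \<le> x v" "\<And>v. v \<in> S \<Longrightarrow> x v \<le> D"
    and spread: "25 / 2 * D \<le> real k / real (card S) * sum x S"
  shows "card S choose k \<le> 2 * card (heavy_sets S k x)"
proof -
  define C where "C = real (card S choose k)"
  define m where "m = real k / real (card S) * sum x S"
  let ?L = "nsets S k - heavy_sets S k x"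
  have m: "0 \<le> m"
    unfolding m_def using x(1) by (intro mult_nonneg_nonneg sum_nonneg) auto
  have "real (card ?L) * (2 / 5 * m)\<^sup>2 \<le> real k / real (card S) * C * (\<Sum>v\<in>S. (x v)\<^sup>2)"
    unfolding m_def C_def by (rule card_light_nsets_le[OF S k x(1)])
  also have "\<dots> \<le> real k / real (card S) * C * (\<Sum>v\<in>S. D * x v)"
    using x by (intro mult_left_mono sum_mono)
      (auto simp: power2_eq_square C_def intro!: mult_right_mono)
  also have "\<dots> = C * m * D"
    by (simp add: m_def sum_distrib_left[symmetric])
  also have "\<dots> \<le> C * m * (2 / 25 * m)"
    using spread[folded m_def] m by (intro mult_left_mono) (simp_all add: C_def)
  finally have "real (card ?L) * (4 * m\<^sup>2) \<le> C / 2 * (4 * m\<^sup>2)"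
    by (simp add: power2_eq_square)
  then have "real (card ?L) \<le> C / 2"
  proof (cases "m = 0")
    case True
    then have light: "?L = {}"
      using x(1) by (auto simp: heavy_sets_def m_def nsets_def subset_iff intro!: sum_nonneg)
    show ?thesis
      unfolding light by (simp add: C_def)
  qed (simp add: mult_le_cancel_right)
  moreover have "card (nsets S k) = card ?L + card (heavy_sets S k x)"
    using finite_imp_finite_nsets[OF S] heavy_sets_subset
    by (metis card_Diff_subset card_mono finite_subset le_add_diff_inverse2)
  ultimately show ?thesis
    by (simp add: C_def)
qed

section \<open>Fractional covers of independent sets\<close>

lemma indep_iff_disjoint_nsets: "indep I G \<longleftrightarrow> nsets I 2 \<inter> G = {}"
  unfolding indep_def disjoint_iff by (metis doubleton_in_nsets_2 nsets2_E)

definition fractional_cover :: "'a set set \<Rightarrow> 'a set set \<Rightarrow> ('a set \<Rightarrow> real) \<Rightarrow> bool" where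
  "fractional_cover K G w \<longleftrightarrow>
     (\<forall>e. 0 \<le> w e \<and> w e \<le> 1) \<and> (\<forall>I\<in>K. indep I G \<longrightarrow> 1 \<le> (\<Sum>e\<in>nsets I 2. w e))"

definition cover_number :: "'a set \<Rightarrow> 'a set set \<Rightarrow> 'a set set \<Rightarrow> real" where
  "cover_number S K G = Inf {\<Sum>e\<in>nsets S 2. w e | w. fractional_cover K G w}"

lemma fractional_cover_bounds:
  assumes "fractional_cover K G w"
  shows "0 \<le> w e" "w e \<le> 1"
  using assms by (auto simp: fractional_cover_def)

lemma cover_number_le:
  assumes "fractional_cover K G w"
  shows "cover_number S K G \<le> (\<Sum>e\<in>nsets S 2. w e)"
  unfolding cover_number_def
proof (rule cInf_lower)
  show "bdd_below {\<Sum>e\<in>nsets S 2. w e |w. fractional_cover K G w}"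
    by (rule bdd_belowI[of _ 0]) (auto simp: fractional_cover_def intro!: sum_nonneg)
qed (use assms in auto)

lemma fractional_cover_one:
  assumes "K \<subseteq> nsets S k" "k \<ge> 2"
  shows "fractional_cover K G (\<lambda>_. 1)"
proof -
  have "1 \<le> real (card I choose 2)" if "I \<in> K" for I
    using that assms choose_two_pos[of k] by (auto simp: nsets_def)
  then show ?thesis
    by (simp add: fractional_cover_def)
qed

lemma cover_number_greatest:
  assumes "K \<subseteq> nsets S k" "k \<ge> 2"
    and "\<And>w. fractional_cover K G w \<Longrightarrow> z \<le> (\<Sum>e\<in>nsets S 2. w e)"
  shows "z \<le> cover_number S K G"
  unfolding cover_number_def
  by (rule cInf_greatest) (use fractional_cover_one[OF assms(1,2)] assms(3) in auto)

lemma fractional_cover_insert: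
  assumes "fractional_cover K G w"
  shows "fractional_cover K (insert e G) w"
  using assms by (auto simp: fractional_cover_def indep_iff_disjoint_nsets)

lemma fractional_cover_delete:
  assumes w: "fractional_cover K (insert e G) w" and K: "K \<subseteq> nsets S k"
  shows "fractional_cover K G (w(e := 1))"
  unfolding fractional_cover_def
proof (intro conjI allI ballI impI)
  fix I assume I: "I \<in> K" "indep I G"
  show "1 \<le> (\<Sum>f\<in>nsets I 2. (w(e := 1)) f)"
  proof (cases "e \<in> nsets I 2")
    case True
    have "finite (nsets I 2)"
      using I K by (intro finite_imp_finite_nsets) (auto simp: nsets_def)
    then show ?thesis
      using True fractional_cover_bounds(1)[OF w]
      by (subst sum.remove[of _ e]) (auto intro!: sum_nonneg)
  next
    case False
    then have "1 \<le> (\<Sum>f\<in>nsets I 2. w f)"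
      using w I by (auto simp: fractional_cover_def indep_iff_disjoint_nsets)
    also have "\<dots> = (\<Sum>f\<in>nsets I 2. (w(e := 1)) f)"
      using False by (intro sum.cong) auto
    finally show ?thesis .
  qed
qed (use fractional_cover_bounds[OF w] in auto)

lemma cover_number_lipschitz:
  assumes S: "finite S" and K: "K \<subseteq> nsets S k" "k \<ge> 2"
  shows "\<bar>cover_number S K (insert e G) - cover_number S K G\<bar> \<le> of_bool (e \<in> nsets S 2)"
proof -
  have "cover_number S K G - of_bool (e \<in> nsets S 2) \<le> cover_number S K (insert e G)"
  proof (rule cover_number_greatest[OF K])
    fix w assume w: "fractional_cover K (insert e G) w"
    have "cover_number S K G \<le> (\<Sum>f\<in>nsets S 2. (w(e := 1)) f)"
      by (intro cover_number_le fractional_cover_delete[OF w K(1)])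
    also have "\<dots> \<le> (\<Sum>f\<in>nsets S 2. w f + of_bool (f = e))"
      using fractional_cover_bounds[OF w] by (intro sum_mono) auto
    also have "\<dots> = (\<Sum>f\<in>nsets S 2. w f) + of_bool (e \<in> nsets S 2)"
      using finite_imp_finite_nsets[OF S] by (simp add: sum.distrib of_bool_def)
    finally show "cover_number S K G - of_bool (e \<in> nsets S 2) \<le> (\<Sum>f\<in>nsets S 2. w f)"
      by simp
  qed
  moreover have "cover_number S K (insert e G) \<le> cover_number S K G"
    by (intro cover_number_greatest[OF K] cover_number_le fractional_cover_insert)
  ultimately show ?thesis
    by (simp add: abs_le_iff)
qed

definition edge_count :: "'a set set \<Rightarrow> 'a set \<Rightarrow> nat" where
  "edge_count E S = card (E \<inter> nsets S 2)"

lemma indep_set_few_edges: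
  assumes S: "finite S" "card S > 0" and K: "K \<subseteq> nsets S k" "k > 0"
    and cover: "(real (card S))\<^sup>2 / (8 * (real k)\<^sup>2) \<le> cover_number S K G"
  shows "\<exists>I\<in>K. indep I G \<and>
    real (edge_count E I) \<le> 8 * (real k)\<^sup>2 * real (edge_count E S) / (real (card S))\<^sup>2"
proof (rule ccontr)
  define \<rho> where "\<rho> = 8 * (real k)\<^sup>2 * real (edge_count E S) / (real (card S))\<^sup>2"
  define r where "r = nat \<lfloor>\<rho>\<rfloor> + 1"
  define w where "w = (\<lambda>e. if e \<in> E then 1 / real r else 0)"
  have \<rho>: "0 \<le> \<rho>" and r: "\<rho> < real r" "0 < r"
    by (simp_all add: \<rho>_def r_def) linarith
  have sum_w: "(\<Sum>e\<in>nsets I 2. w e) = real (edge_count E I) / real r" if "finite I" for I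
    using finite_imp_finite_nsets[OF that, of 2]
    by (simp add: w_def edge_count_def sum.If_cases Int_commute)
  assume "\<not> ?thesis"
  then have many: "\<rho> < real (edge_count E I)" if "I \<in> K" "indep I G" for I
    using that unfolding \<rho>_def by (meson not_le_imp_less)
  have "fractional_cover K G w"
    unfolding fractional_cover_def
  proof (intro conjI allI ballI impI)
    fix I assume I: "I \<in> K" "indep I G"
    have "r \<le> edge_count E I"
      unfolding r_def using many[OF I] \<rho> by linarith
    then show "1 \<le> (\<Sum>e\<in>nsets I 2. w e)"
      using I K r by (subst sum_w) (auto simp: nsets_def)
  qed (use r in \<open>auto simp: w_def\<close>)
  from cover_number_le[OF this, of S] cover
  have "(real (card S))\<^sup>2 / (8 * (real k)\<^sup>2) \<le> real (edge_count E S) / real r"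
    by (simp add: sum_w S)
  then have "real r \<le> \<rho>"
    unfolding \<rho>_def using r(2) K(2) S(2) by (simp add: field_simps)
  with r show False by simp
qed

text \<open>The pair \<open>e\<close> itself is not required to be a non-edge: otherwise the count would vanish with
  probability \<open>p\<close> and would not be concentrated.\<close>

definition extension_count :: "'a set \<Rightarrow> nat \<Rightarrow> 'a set \<Rightarrow> 'a set set \<Rightarrow> nat" where
  "extension_count S k e G = card {I \<in> nsets_above S k e. indep I (G - {e})}"

lemma sum_pairs_double_count:
  fixes w :: "'a set \<Rightarrow> real"
  assumes S: "finite S" and N: "N \<subseteq> nsets S k"
  shows "(\<Sum>I\<in>N. \<Sum>e\<in>nsets I 2. w e) = (\<Sum>e\<in>nsets S 2. w e * real (card {I \<in> N. e \<subseteq> I}))"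
proof -
  have "(\<Sum>I\<in>N. \<Sum>e\<in>nsets I 2. w e) = (\<Sum>I\<in>N. \<Sum>e | e \<in> nsets S 2 \<and> e \<subseteq> I. w e)"
    using N by (intro sum.cong refl) (auto simp: nsets_def)
  also have "\<dots> = (\<Sum>e\<in>nsets S 2. \<Sum>I | I \<in> N \<and> e \<subseteq> I. w e)"
    using S finite_subset[OF N finite_imp_finite_nsets[OF S]]
    by (intro sum.swap_restrict finite_imp_finite_nsets)
  finally show ?thesis
    by (simp add: mult.commute)
qed

lemma cover_number_lower_bound:
  assumes S: "finite S" and K: "K \<subseteq> nsets S k" "k \<ge> 2" and a: "a > 0"
  shows "real (card {I \<in> K. indep I G}) - (\<Sum>e\<in>nsets S 2. max 0 (real (extension_count S k e G) - a))
    \<le> a * cover_number S K G"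
proof -
  define N where "N = {I \<in> K. indep I G}"
  define excess where "excess = (\<lambda>e. max 0 (real (extension_count S k e G) - a))"
  have "(real (card N) - (\<Sum>e\<in>nsets S 2. excess e)) / a \<le> cover_number S K G"
  proof (rule cover_number_greatest[OF K])
    fix w assume w: "fractional_cover K G w"
    note w_bounds = fractional_cover_bounds[OF w]
    have "real (card N) = (\<Sum>I\<in>N. 1)"
      by simp
    also have "\<dots> \<le> (\<Sum>I\<in>N. \<Sum>e\<in>nsets I 2. w e)"
      using w by (intro sum_mono) (auto simp: fractional_cover_def N_def)
    also have "\<dots> = (\<Sum>e\<in>nsets S 2. w e * real (card {I \<in> N. e \<subseteq> I}))"
      using K(1) by (intro sum_pairs_double_count[OF S]) (auto simp: N_def)
    also have "\<dots> \<le> (\<Sum>e\<in>nsets S 2. a * w e + excess e)"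
    proof (rule sum_mono)
      fix e
      have "card {I \<in> N. e \<subseteq> I} \<le> extension_count S k e G"
        unfolding extension_count_def using K S
        by (intro card_mono) (auto simp: N_def nsets_above_def indep_def finite_imp_finite_nsets)
      then have "w e * real (card {I \<in> N. e \<subseteq> I}) \<le> w e * (a + excess e)"
        using w_bounds by (intro mult_left_mono) (auto simp: excess_def)
      also have "\<dots> = a * w e + w e * excess e"
        by (simp add: algebra_simps)
      also have "w e * excess e \<le> excess e"
        using w_bounds by (intro mult_left_le_one_le) (auto simp: excess_def)
      finally show "w e * real (card {I \<in> N. e \<subseteq> I}) \<le> a * w e + excess e"
        by simp
    qed
    finally show "(real (card N) - (\<Sum>e\<in>nsets S 2. excess e)) / a \<le> (\<Sum>e\<in>nsets S 2. w e)"
      using a by (simp add: sum.distrib sum_distrib_left[symmetric] field_simps)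
  qed
  then show ?thesis
    using a by (simp add: field_simps N_def excess_def)
qed

section \<open>Second moment of the number of independent sets through a pair\<close>

definition overlap_term :: "nat \<Rightarrow> nat \<Rightarrow> real \<Rightarrow> nat \<Rightarrow> real" where
  "overlap_term k m b j =
     real ((k - 2) choose j) * (real k / real m) ^ j * (b ^ (((j + 2) choose 2) - 1) - 1)"

definition overlap_sum :: "nat \<Rightarrow> nat \<Rightarrow> real \<Rightarrow> real" where
  "overlap_sum k m b = (\<Sum>j\<le>k - 2. overlap_term k m b j)"

lemma overlap_sum_nonneg: "1 \<le> b \<Longrightarrow> 0 \<le> overlap_sum k m b"
  unfolding overlap_sum_def overlap_term_def
  by (intro sum_nonneg mult_nonneg_nonneg) (auto simp: one_le_power)

lemma sum_card_Int_le:
  fixes \<phi> :: "nat \<Rightarrow> real"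
  assumes S: "finite S" and I: "finite I" "U \<subseteq> I" and \<phi>: "\<And>i. 0 \<le> \<phi> i"
  shows "(\<Sum>J\<in>nsets_above S k U. \<phi> (card (I \<inter> J)))
    \<le> (\<Sum>T | U \<subseteq> T \<and> T \<subseteq> I. real (card (nsets_above S k T)) * \<phi> (card T))"
proof -
  define \<T> where "\<T> = {T. U \<subseteq> T \<and> T \<subseteq> I}"
  have fin: "finite \<T>"
    using I by (auto simp: \<T>_def intro: finite_subset[of _ "Pow I"])
  have "(\<Sum>J\<in>nsets_above S k U. \<phi> (card (I \<inter> J))) \<le>
      (\<Sum>J\<in>nsets_above S k U. \<Sum>T | T \<in> \<T> \<and> T \<subseteq> J. \<phi> (card T))"
  proof (rule sum_mono)
    fix J assume "J \<in> nsets_above S k U"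
    then have "(\<Sum>T\<in>{I \<inter> J}. \<phi> (card T)) \<le> (\<Sum>T | T \<in> \<T> \<and> T \<subseteq> J. \<phi> (card T))"
      using fin I \<phi> by (intro sum_mono2) (auto simp: \<T>_def nsets_above_def)
    then show "\<phi> (card (I \<inter> J)) \<le> (\<Sum>T | T \<in> \<T> \<and> T \<subseteq> J. \<phi> (card T))"
      by simp
  qed
  also have "\<dots> = (\<Sum>T\<in>\<T>. \<Sum>J | J \<in> nsets_above S k U \<and> T \<subseteq> J. \<phi> (card T))"
    using S fin by (intro sum.swap_restrict) auto
  also have "\<dots> = (\<Sum>T\<in>\<T>. real (card (nsets_above S k T)) * \<phi> (card T))"
  proof (rule sum.cong[OF refl])
    fix T assume "T \<in> \<T>"
    then have "{J \<in> nsets_above S k U. T \<subseteq> J} = nsets_above S k T"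
      by (auto simp: \<T>_def nsets_above_def)
    then show "(\<Sum>J | J \<in> nsets_above S k U \<and> T \<subseteq> J. \<phi> (card T)) =
        real (card (nsets_above S k T)) * \<phi> (card T)"
      by simp
  qed
  finally show ?thesis
    by (simp add: \<T>_def)
qed

lemma sum_between_card:
  fixes \<psi> :: "nat \<Rightarrow> real"
  assumes I: "finite I" and U: "U \<subseteq> I"
  shows "(\<Sum>T | U \<subseteq> T \<and> T \<subseteq> I. \<psi> (card T)) =
    (\<Sum>j\<le>card I - card U. real ((card I - card U) choose j) * \<psi> (card U + j))"
proof -
  define \<T> where "\<T> = {T. U \<subseteq> T \<and> T \<subseteq> I}"
  have fin: "finite \<T>"
    using I by (auto simp: \<T>_def intro: finite_subset[of _ "Pow I"])
  have card_T: "card U \<le> card T" "card T \<le> card I" if "T \<in> \<T>" for T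
    using that I by (auto simp: \<T>_def intro!: card_mono finite_subset[of T I])
  have "(\<Sum>T\<in>\<T>. \<psi> (card T)) =
      (\<Sum>j\<le>card I - card U. \<Sum>T | T \<in> \<T> \<and> card T - card U = j. \<psi> (card T))"
    using fin card_T by (intro sum.group[symmetric]) (auto intro: diff_le_mono)
  also have "\<dots> = (\<Sum>j\<le>card I - card U. real ((card I - card U) choose j) * \<psi> (card U + j))"
  proof (rule sum.cong[OF refl])
    fix j
    have "card T - card U = j \<longleftrightarrow> card T = card U + j" if "T \<in> \<T>" for T
      using card_T(1)[OF that] by auto
    then have "{T \<in> \<T>. card T - card U = j} = {T \<in> \<T>. card T = card U + j}"
      by blast
    also have "\<dots> = nsets_above I (card U + j) U"
      using finite_subset[OF _ I] by (auto simp: \<T>_def nsets_above_def nsets_def)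
    finally have "{T \<in> \<T>. card T - card U = j} = nsets_above I (card U + j) U" .
    then show "(\<Sum>T | T \<in> \<T> \<and> card T - card U = j. \<psi> (card T)) =
        real ((card I - card U) choose j) * \<psi> (card U + j)"
      using card_nsets_above[OF I U, of "card U + j"] by (simp add: nsets_above_def nsets_def)
  qed
  finally show ?thesis
    by (simp add: \<T>_def)
qed

lemma binomial_overlap_le:
  assumes "2 \<le> k" "k \<le> n" "j \<le> k - 2"
  shows "real ((n - 2 - j) choose (k - 2 - j)) \<le>
    (real k / real n) ^ j * real ((n - 2) choose (k - 2))"
proof -
  have "real ((n - 2 - j) choose (k - 2 - j)) \<le>
      (real (k - 2) / real (n - 2)) ^ j * real ((n - 2) choose (k - 2))"
    using assms by (intro binomial_diff_le) auto
  moreover have "real (k - 2) / real (n - 2) \<le> real k / real n"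
    using assms by (cases "n = 2") (simp_all add: of_nat_diff divide_simps algebra_simps)
  then have "(real (k - 2) / real (n - 2)) ^ j * real ((n - 2) choose (k - 2)) \<le>
      (real k / real n) ^ j * real ((n - 2) choose (k - 2))"
    by (intro mult_right_mono power_mono) auto
  ultimately show ?thesis
    by (rule order_trans)
qed

lemma sum_overlap_le:
  assumes S: "finite S" and e: "card e = 2" and I: "I \<in> nsets_above S k e" and b: "b \<ge> 1"
  shows "(\<Sum>J\<in>nsets_above S k e. b ^ ((card (I \<inter> J) choose 2) - 1) - 1)
    \<le> real ((card S - 2) choose (k - 2)) * overlap_sum k (card S) b"
proof -
  define \<phi> where "\<phi> = (\<lambda>i. b ^ ((i choose 2) - 1) - 1)"
  define s where "s = card S"
  note I = nsets_aboveD[OF I]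
  have \<phi>: "0 \<le> \<phi> i" for i
    using b by (simp add: \<phi>_def one_le_power)
  have k: "2 \<le> k" and ks: "k \<le> s"
    using card_mono[OF I(2,4)] card_mono[OF S I(1)] I(3) e by (auto simp: s_def)
  have "(\<Sum>J\<in>nsets_above S k e. \<phi> (card (I \<inter> J)))
      \<le> (\<Sum>T | e \<subseteq> T \<and> T \<subseteq> I. real (card (nsets_above S k T)) * \<phi> (card T))"
    by (rule sum_card_Int_le[OF S I(2,4) \<phi>])
  also have "\<dots> = (\<Sum>T | e \<subseteq> T \<and> T \<subseteq> I. real ((s - card T) choose (k - card T)) * \<phi> (card T))"
  proof (intro sum.cong refl)
    fix T assume "T \<in> {T. e \<subseteq> T \<and> T \<subseteq> I}"
    then have "T \<subseteq> S" "card T \<le> k"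
      using I card_mono[of I T] by auto
    then show "real (card (nsets_above S k T)) * \<phi> (card T) =
        real ((s - card T) choose (k - card T)) * \<phi> (card T)"
      by (simp add: card_nsets_above[OF S] s_def)
  qed
  also have "\<dots> =
      (\<Sum>j\<le>k - 2. real ((k - 2) choose j) * (real ((s - 2 - j) choose (k - 2 - j)) * \<phi> (2 + j)))"
    unfolding sum_between_card[OF I(2,4), of "\<lambda>t. real ((s - t) choose (k - t)) * \<phi> t"] I(3) e
    by (simp add: diff_diff_add)
  also have "\<dots> \<le> (\<Sum>j\<le>k - 2. real ((k - 2) choose j) *
      ((real k / real s) ^ j * real ((s - 2) choose (k - 2)) * \<phi> (2 + j)))"
    using k ks by (intro sum_mono mult_left_mono mult_right_mono \<phi> binomial_overlap_le) auto
  also have "\<dots> = real ((s - 2) choose (k - 2)) * overlap_sum k s b"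
    unfolding overlap_sum_def overlap_term_def sum_distrib_left
    by (rule sum.cong) (auto simp: \<phi>_def add.commute)
  finally show ?thesis
    by (simp add: \<phi>_def s_def)
qed

lemma indep_Diff_iff_disjoint: "indep I (G - F) \<longleftrightarrow> (nsets I 2 - F) \<inter> G = {}"
  by (auto simp: indep_iff_disjoint_nsets)

lemma real_extension_count:
  assumes "finite S"
  shows "real (extension_count S k e G) = (\<Sum>I\<in>nsets_above S k e. of_bool (indep I (G - {e})))"
  using assms by (simp add: extension_count_def Collect_conj_eq Int_commute)

lemma card_nsets_Un_Diff:
  assumes I: "finite I" "card I = k" and J: "finite J" "card J = k" and e: "e \<in> nsets (I \<inter> J) 2"
  shows "card (nsets I 2 \<union> nsets J 2 - {e}) + ((card (I \<inter> J) choose 2) - 1) =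
    2 * ((k choose 2) - 1)"
proof -
  have Int: "nsets I 2 \<inter> nsets J 2 = nsets (I \<inter> J) 2"
    by (auto simp: nsets_def)
  have fin: "finite (nsets I 2)" "finite (nsets J 2)"
    using I J by (auto intro: finite_imp_finite_nsets)
  have "card (nsets I 2 \<union> nsets J 2) + (card (I \<inter> J) choose 2) = 2 * (k choose 2)"
    using card_Un_Int[OF fin] I J by (simp add: Int)
  moreover have "1 \<le> card (I \<inter> J) choose 2"
    using e I card_mono[of "nsets (I \<inter> J) 2" "{e}"] by (simp add: finite_imp_finite_nsets)
  moreover have "(card (I \<inter> J) choose 2) \<le> k choose 2"
    using card_mono[OF fin(1), of "nsets (I \<inter> J) 2"] I(2) nsets_mono[of "I \<inter> J" I 2] by simp
  moreover have "card (nsets I 2 \<union> nsets J 2 - {e}) = card (nsets I 2 \<union> nsets J 2) - 1"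
    using e fin Int by (intro card_Diff_singleton) auto
  ultimately show ?thesis
    by linarith
qed

lemma excess_le_square:
  fixes x m :: real
  assumes "m > 0"
  shows "max 0 (x - 3 / 2 * m) \<le> (x - m)\<^sup>2 / (2 * m)"
proof -
  have "2 * m * (x - 3 / 2 * m) \<le> (x - m)\<^sup>2"
    using zero_le_power2[of "x - 2 * m"] by (simp add: power2_eq_square algebra_simps)
  then have "x - 3 / 2 * m \<le> (x - m)\<^sup>2 / (2 * m)"
    using assms by (simp add: field_simps)
  then show ?thesis
    using assms by simp
qed

lemma choose_two_ratio_ge:
  assumes "2 \<le> k" "k \<le> n"
  shows "(real n)\<^sup>2 / (real k)\<^sup>2 \<le> real (n choose 2) / real (k choose 2)"
proof -
  have "real n * (real k - 1) \<le> (real n - 1) * real k"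
    using assms by (simp add: algebra_simps)
  then have "(real n * real k) * (real n * (real k - 1)) \<le>
      (real n * real k) * ((real n - 1) * real k)"
    by (intro mult_left_mono) auto
  then show ?thesis
    using assms by (simp add: real_choose_two power2_eq_square divide_simps algebra_simps)
qed

locale gnp =
  fixes V :: "'a set" and p :: real
  assumes finite_V: "finite V" and p_nonneg: "0 \<le> p" and p_less_1: "p < 1"
begin

abbreviation expectation :: "('a set set \<Rightarrow> real) \<Rightarrow> real" where
  "expectation \<equiv> measure_pmf.expectation (random_subset (nsets V 2) p)"

abbreviation prob :: "'a set set set \<Rightarrow> real" where
  "prob \<equiv> measure_pmf.prob (random_subset (nsets V 2) p)"

lemma finite_pairs [simp]: "finite (nsets V 2)"
  using finite_V by (rule finite_imp_finite_nsets)

lemma expectation_indep: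
  assumes "I \<subseteq> V"
  shows "expectation (\<lambda>G. of_bool (indep I G)) = (1 - p) ^ (card I choose 2)"
  unfolding indep_iff_disjoint_nsets
  using expectation_disjoint[OF finite_pairs nsets_mono[OF assms]] p_nonneg p_less_1 by simp

lemma expectation_card_indep:
  assumes S: "S \<subseteq> V" and K: "K \<subseteq> nsets S k"
  shows "expectation (\<lambda>G. real (card {I \<in> K. indep I G})) = real (card K) * (1 - p) ^ (k choose 2)"
proof -
  have fin: "finite K"
    using K S finite_V by (meson finite_imp_finite_nsets finite_subset)
  have "expectation (\<lambda>G. real (card {I \<in> K. indep I G})) =
      expectation (\<lambda>G. \<Sum>I\<in>K. of_bool (indep I G))"
    using fin by (simp add: Collect_conj_eq Int_commute)
  also have "\<dots> = (\<Sum>I\<in>K. expectation (\<lambda>G. of_bool (indep I G)))"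
    by (simp add: Bochner_Integration.integral_sum)
  also have "\<dots> = (\<Sum>I\<in>K. (1 - p) ^ (k choose 2))"
  proof (rule sum.cong[OF refl])
    fix I assume "I \<in> K"
    then have "I \<subseteq> V" "card I = k"
      using K S unfolding nsets_def by blast+
    then show "expectation (\<lambda>G. of_bool (indep I G)) = (1 - p) ^ (k choose 2)"
      by (simp add: expectation_indep)
  qed
  finally show ?thesis by simp
qed

definition mean_extensions :: "nat \<Rightarrow> nat \<Rightarrow> real" where
  "mean_extensions s k = real ((s - 2) choose (k - 2)) * (1 - p) ^ ((k choose 2) - 1)"

lemma card_nsets_above_pair:
  assumes "S \<subseteq> V" "e \<in> nsets S 2" "2 \<le> k"
  shows "card (nsets_above S k e) = (card S - 2) choose (k - 2)"
  using assms finite_V by (subst card_nsets_above) (auto simp: nsets_def intro: finite_subset)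

lemma expectation_extension_count:
  assumes S: "S \<subseteq> V" and e: "e \<in> nsets S 2" and k: "2 \<le> k"
  shows "expectation (\<lambda>G. real (extension_count S k e G)) = mean_extensions (card S) k"
proof -
  have "finite S"
    using S finite_V by (rule finite_subset)
  then have "expectation (\<lambda>G. real (extension_count S k e G)) =
      (\<Sum>I\<in>nsets_above S k e. expectation (\<lambda>G. of_bool (indep I (G - {e}))))"
    by (simp add: real_extension_count Bochner_Integration.integral_sum del: sum_of_bool_eq)
  also have "\<dots> = (\<Sum>I\<in>nsets_above S k e. (1 - p) ^ ((k choose 2) - 1))"
  proof (rule sum.cong[OF refl])
    fix I assume I: "I \<in> nsets_above S k e"
    note I' = nsets_aboveD[OF I]
    have "nsets I 2 - {e} \<subseteq> nsets V 2"
      using nsets_mono[of I V 2] I'(1) S by auto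
    moreover have "e \<in> nsets I 2"
      using I' e by (auto simp: nsets_def)
    then have "card (nsets I 2 - {e}) = (k choose 2) - 1"
      using I' by (simp add: card_Diff_singleton)
    ultimately show "expectation (\<lambda>G. of_bool (indep I (G - {e}))) = (1 - p) ^ ((k choose 2) - 1)"
      unfolding indep_Diff_iff_disjoint using p_nonneg p_less_1 by (simp add: expectation_disjoint)
  qed
  finally show ?thesis
    by (simp add: card_nsets_above_pair assms mean_extensions_def)
qed

lemma expectation_indep_indep:
  assumes S: "S \<subseteq> V" and e: "e \<in> nsets S 2"
    and I: "I \<in> nsets_above S k e" and J: "J \<in> nsets_above S k e"
  shows "expectation (\<lambda>G. of_bool (indep I (G - {e})) * of_bool (indep J (G - {e}))) =
    (1 - p) ^ (2 * ((k choose 2) - 1)) * (1 / (1 - p)) ^ ((card (I \<inter> J) choose 2) - 1)"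
proof -
  define U where "U = nsets I 2 \<union> nsets J 2 - {e}"
  note I = nsets_aboveD[OF I] and J = nsets_aboveD[OF J]
  have "U \<subseteq> nsets V 2"
    using nsets_mono[of I V 2] nsets_mono[of J V 2] I(1) J(1) S by (auto simp: U_def)
  then have "expectation (\<lambda>G. of_bool (U \<inter> G = {})) = (1 - p) ^ card U"
    using p_nonneg p_less_1 by (intro expectation_disjoint) auto
  also have "\<dots> = (1 - p) ^ (card U + ((card (I \<inter> J) choose 2) - 1)) *
      (1 / (1 - p)) ^ ((card (I \<inter> J) choose 2) - 1)"
    using p_less_1 by (simp add: power_add power_one_over)
  also have "card U + ((card (I \<inter> J) choose 2) - 1) = 2 * ((k choose 2) - 1)"
    unfolding U_def using I J e by (intro card_nsets_Un_Diff) (auto simp: nsets_def)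
  also have "(\<lambda>G. of_bool (U \<inter> G = {})) =
      (\<lambda>G. of_bool (indep I (G - {e})) * of_bool (indep J (G - {e})) :: real)"
    by (auto simp: U_def indep_Diff_iff_disjoint fun_eq_iff of_bool_def)
  finally show ?thesis .
qed

lemma variance_extension_count_le:
  assumes S: "S \<subseteq> V" and e: "e \<in> nsets S 2" and k: "2 \<le> k"
  defines "\<mu> \<equiv> mean_extensions (card S) k"
  shows "expectation (\<lambda>G. (real (extension_count S k e G) - \<mu>)\<^sup>2)
    \<le> \<mu>\<^sup>2 * overlap_sum k (card S) (1 / (1 - p))"
proof -
  define b where "b = 1 / (1 - p)"
  define F where "F = nsets_above S k e"
  define q where "q = (1 - p) ^ (2 * ((k choose 2) - 1))"
  have fin: "finite S"
    using S finite_V by (rule finite_subset)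
  have mean: "expectation (\<lambda>G. real (extension_count S k e G)) = \<mu>"
    unfolding \<mu>_def by (rule expectation_extension_count[OF S e k])
  have \<mu>_squared: "\<mu>\<^sup>2 = q * (real (card F))\<^sup>2"
    by (simp add: \<mu>_def mean_extensions_def F_def q_def card_nsets_above_pair S e k
        power_mult_distrib power_even_eq)
  have "expectation (\<lambda>G. (real (extension_count S k e G))\<^sup>2) =
      (\<Sum>I\<in>F. \<Sum>J\<in>F. expectation (\<lambda>G. of_bool (indep I (G - {e})) * of_bool (indep J (G - {e}))))"
    unfolding real_extension_count[OF fin] F_def[symmetric] power2_eq_square sum_product
    by (simp add: Bochner_Integration.integral_sum)
  then have second: "expectation (\<lambda>G. (real (extension_count S k e G))\<^sup>2) =
      (\<Sum>I\<in>F. \<Sum>J\<in>F. q * b ^ ((card (I \<inter> J) choose 2) - 1))"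
    by (simp add: F_def q_def b_def expectation_indep_indep[OF S e] cong: sum.cong)
  have "expectation (\<lambda>G. (real (extension_count S k e G) - \<mu>)\<^sup>2) =
      expectation (\<lambda>G. (real (extension_count S k e G))\<^sup>2) - \<mu>\<^sup>2"
    using measure_pmf.variance_eq[of "random_subset (nsets V 2) p"
        "\<lambda>G. real (extension_count S k e G)"] by (simp add: mean)
  also have "\<dots> = q * (\<Sum>I\<in>F. \<Sum>J\<in>F. b ^ ((card (I \<inter> J) choose 2) - 1) - 1)"
    unfolding second \<mu>_squared
    by (simp add: sum_subtractf sum_distrib_left right_diff_distrib power2_eq_square mult_ac)
  also have "\<dots> \<le> q * (\<Sum>I\<in>F. real ((card S - 2) choose (k - 2)) * overlap_sum k (card S) b)"
    unfolding F_def q_def using p_nonneg p_less_1 e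
    by (intro mult_left_mono sum_mono sum_overlap_le fin) (auto simp: b_def nsets_def)
  also have "\<dots> = \<mu>\<^sup>2 * overlap_sum k (card S) b"
    unfolding \<mu>_squared by (simp add: F_def card_nsets_above_pair S e k power2_eq_square)
  finally show ?thesis
    by (simp add: b_def)
qed

lemma mean_extensions_pos: "2 \<le> k \<Longrightarrow> k \<le> s \<Longrightarrow> 0 < mean_extensions s k"
  using p_less_1 by (auto simp: mean_extensions_def)

lemma expectation_excess_le:
  assumes S: "S \<subseteq> V" and e: "e \<in> nsets S 2" and k: "2 \<le> k" "k \<le> card S"
  defines "\<mu> \<equiv> mean_extensions (card S) k"
  shows "expectation (\<lambda>G. max 0 (real (extension_count S k e G) - 3 / 2 * \<mu>))
    \<le> \<mu> * overlap_sum k (card S) (1 / (1 - p)) / 2"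
proof -
  have \<mu>: "\<mu> > 0"
    unfolding \<mu>_def using k by (rule mean_extensions_pos)
  have "expectation (\<lambda>G. max 0 (real (extension_count S k e G) - 3 / 2 * \<mu>)) \<le>
      expectation (\<lambda>G. (real (extension_count S k e G) - \<mu>)\<^sup>2 / (2 * \<mu>))"
    using excess_le_square[OF \<mu>] by (intro integral_mono) auto
  also have "\<dots> = expectation (\<lambda>G. (real (extension_count S k e G) - \<mu>)\<^sup>2) / (2 * \<mu>)"
    by simp
  also have "\<dots> \<le> \<mu>\<^sup>2 * overlap_sum k (card S) (1 / (1 - p)) / (2 * \<mu>)"
    unfolding \<mu>_def using \<mu>[unfolded \<mu>_def]
    by (intro divide_right_mono variance_extension_count_le S e k) auto
  finally show ?thesis
    using \<mu> by (simp add: power2_eq_square)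
qed

lemma card_indep_expectation_ge:
  assumes k: "2 \<le> k" "k \<le> s" and p: "p \<le> 1 / 2" and dense: "s choose k \<le> 2 * N"
  shows "real (s choose 2) * mean_extensions s k / 4 \<le>
    real (k choose 2) * (real N * (1 - p) ^ (k choose 2))"
proof -
  have "(1 - p) ^ (k choose 2) = (1 - p) * (1 - p) ^ ((k choose 2) - 1)"
    using k power_minus_mult[of "k choose 2" "1 - p"] by (simp add: mult.commute)
  moreover have "real (s choose k) * real (k choose 2) =
      real (s choose 2) * real ((s - 2) choose (k - 2))"
    unfolding of_nat_mult[symmetric] using k by (subst choose_mult) auto
  ultimately have "real (k choose 2) * (real (s choose k) * (1 - p) ^ (k choose 2)) =
      real (s choose 2) * mean_extensions s k * (1 - p)"
    by (simp add: mean_extensions_def mult_ac)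
  moreover have "real (s choose 2) * mean_extensions s k * (1 / 2) \<le>
      real (s choose 2) * mean_extensions s k * (1 - p)"
    using p mean_extensions_pos[OF k] by (intro mult_left_mono) auto
  moreover have "real (k choose 2) * (real (s choose k) / 2 * (1 - p) ^ (k choose 2)) \<le>
      real (k choose 2) * (real N * (1 - p) ^ (k choose 2))"
    using dense p_less_1 by (intro mult_left_mono mult_right_mono) auto
  ultimately show ?thesis
    by simp
qed

lemma cover_number_expectation_lower_bound:
  assumes S: "S \<subseteq> V" and K: "K \<subseteq> nsets S k" and k: "2 \<le> k" "k \<le> card S"
  defines "\<mu> \<equiv> mean_extensions (card S) k"
  shows "real (card K) * (1 - p) ^ (k choose 2) -
      real (card S choose 2) * (\<mu> * overlap_sum k (card S) (1 / (1 - p)) / 2)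
    \<le> 3 / 2 * \<mu> * expectation (cover_number S K)"
proof -
  have fin: "finite S"
    using S finite_V by (rule finite_subset)
  have "(\<Sum>e\<in>nsets S 2. expectation (\<lambda>G. max 0 (real (extension_count S k e G) - 3 / 2 * \<mu>)))
      \<le> (\<Sum>e\<in>nsets S 2. \<mu> * overlap_sum k (card S) (1 / (1 - p)) / 2)"
    unfolding \<mu>_def by (intro sum_mono expectation_excess_le S k)
  then have "real (card K) * (1 - p) ^ (k choose 2) -
      real (card S choose 2) * (\<mu> * overlap_sum k (card S) (1 / (1 - p)) / 2) \<le>
      expectation (\<lambda>G. real (card {I \<in> K. indep I G})) -
        (\<Sum>e\<in>nsets S 2. expectation (\<lambda>G. max 0 (real (extension_count S k e G) - 3 / 2 * \<mu>)))"
    unfolding expectation_card_indep[OF S K] by simp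
  also have "\<dots> = expectation (\<lambda>G. real (card {I \<in> K. indep I G}) -
        (\<Sum>e\<in>nsets S 2. max 0 (real (extension_count S k e G) - 3 / 2 * \<mu>)))"
    by (simp add: Bochner_Integration.integral_sum)
  also have "\<dots> \<le> expectation (\<lambda>G. 3 / 2 * \<mu> * cover_number S K G)"
    unfolding \<mu>_def using mean_extensions_pos[OF k]
    by (intro integral_mono cover_number_lower_bound fin K k) auto
  finally show ?thesis
    by simp
qed

lemma expectation_cover_number_ge:
  assumes S: "S \<subseteq> V" and K: "K \<subseteq> nsets S k" and k: "2 \<le> k" "k \<le> card S" and p: "p \<le> 1 / 2"
    and dense: "card S choose k \<le> 2 * card K"
    and overlap: "(real k)\<^sup>2 * overlap_sum k (card S) (1 / (1 - p)) \<le> 1 / 10"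
  shows "(real (card S))\<^sup>2 / (7 * (real k)\<^sup>2) \<le> expectation (cover_number S K)"
proof -
  define \<mu> where "\<mu> = mean_extensions (card S) k"
  define \<nu> where "\<nu> = overlap_sum k (card S) (1 / (1 - p))"
  define N where "N = real (card S choose 2)"
  define c where "c = real (k choose 2)"
  let ?X = "expectation (cover_number S K)"
  have \<mu>: "\<mu> > 0"
    unfolding \<mu>_def using k by (rule mean_extensions_pos)
  have c: "c > 0"
    using k by (simp add: c_def)
  have "c * \<nu> \<le> (real k)\<^sup>2 / 2 * \<nu>"
    using p_nonneg p_less_1 k unfolding \<nu>_def
    by (intro mult_right_mono overlap_sum_nonneg)
      (auto simp: c_def real_choose_two power2_eq_square field_simps)
  then have "c * \<nu> \<le> 1 / 20"
    using overlap by (simp add: \<nu>_def)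
  then have "N * \<mu> / 4 - N * \<mu> / 2 * (1 / 20) \<le> N * \<mu> / 4 - N * \<mu> / 2 * (c * \<nu>)"
    using \<mu> by (intro diff_left_mono mult_left_mono) (auto simp: N_def)
  also have "\<dots> \<le> c * (real (card K) * (1 - p) ^ (k choose 2) - N * (\<mu> * \<nu> / 2))"
    using card_indep_expectation_ge[OF k p dense] by (simp add: c_def N_def \<mu>_def algebra_simps)
  also have "\<dots> \<le> c * (3 / 2 * \<mu> * ?X)"
    unfolding c_def N_def \<mu>_def \<nu>_def
    by (intro mult_left_mono cover_number_expectation_lower_bound S K k) simp
  finally have "\<mu> * (N * (9 / 40)) \<le> \<mu> * (c * (3 / 2 * ?X))"
    by (simp add: algebra_simps)
  then have "3 / 20 * (N / c) \<le> ?X"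
    using \<mu> c by (simp add: field_simps)
  moreover have "1 / 7 * ((real (card S))\<^sup>2 / (real k)\<^sup>2) \<le> 3 / 20 * (N / c)"
    unfolding N_def c_def by (intro mult_mono choose_two_ratio_ge k) auto
  ultimately show ?thesis
    by simp
qed

end

section \<open>Pseudorandom properties of the random graph\<close>

definition richly_independent :: "'a set \<Rightarrow> nat \<Rightarrow> real \<Rightarrow> 'a set set \<Rightarrow> bool" where
  "richly_independent V k s G \<longleftrightarrow> (\<forall>S \<subseteq> V. \<forall>x \<in> V \<rightarrow>\<^sub>E {..card V}.
     let K = heavy_sets S k (\<lambda>v. real (x v)) in
       s \<le> real (card S) \<longrightarrow> card S choose k \<le> 2 * card K \<longrightarrow>
       (real (card S))\<^sup>2 / (8 * (real k)\<^sup>2) \<le> cover_number S K G)"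

definition locally_sparse :: "'a set \<Rightarrow> real \<Rightarrow> real \<Rightarrow> 'a set set \<Rightarrow> bool" where
  "locally_sparse V s a G \<longleftrightarrow> (\<forall>T \<subseteq> V. real (card T) \<le> s \<longrightarrow> real (edge_count G T) \<le> a * real (card T))"

lemma sum_power_card_Pow:
  fixes y :: "'b :: comm_semiring_1"
  assumes "finite A"
  shows "(\<Sum>T\<in>Pow A. y ^ card T) = (1 + y) ^ card A"
  using prod_add[OF assms, of "\<lambda>_. y" "\<lambda>_. 1"] by (simp add: add.commute)

context gnp
begin

lemma prob_bex_le:
  assumes "finite J" "\<And>j. j \<in> J \<Longrightarrow> prob {G. P j G} \<le> c j"
  shows "prob {G. \<exists>j\<in>J. P j G} \<le> (\<Sum>j\<in>J. c j)"
proof -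
  have "prob {G. \<exists>j\<in>J. P j G} = prob (\<Union>j\<in>J. {G. P j G})"
    by (rule arg_cong[where f = prob]) auto
  also have "\<dots> \<le> (\<Sum>j\<in>J. prob {G. P j G})"
    using assms(1) by (intro measure_pmf.finite_measure_subadditive_finite) auto
  also have "\<dots> \<le> (\<Sum>j\<in>J. c j)"
    using assms(2) by (rule sum_mono)
  finally show ?thesis .
qed

lemma cover_number_lower_tail:
  assumes S: "S \<subseteq> V" and K: "K \<subseteq> nsets S k" and k: "2 \<le> k" "k \<le> card S"
    and p: "0 < p" "p \<le> 1 / 2" "1 \<le> (real k)\<^sup>2 * p"
    and dense: "card S choose k \<le> 2 * card K"
    and overlap: "(real k)\<^sup>2 * overlap_sum k (card S) (1 / (1 - p)) \<le> 1 / 10"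
  shows "prob {G. cover_number S K G < (real (card S))\<^sup>2 / (8 * (real k)\<^sup>2)}
    \<le> exp (- ((real (card S))\<^sup>2 / (6272 * (real k ^ 4 * p))))"
proof -
  \<comment> \<open>\<open>1 / 7 - 1 / 8 = 1 / 56\<close>, and this \<open>l\<close> minimises the exponent of the tail bound\<close>
  define l where "l = 1 / (56 * ((real k)\<^sup>2 * p))"
  define t where "t = (real (card S))\<^sup>2 / (56 * (real k)\<^sup>2)"
  have fin: "finite S"
    using S finite_V by (rule finite_subset)
  have pairs: "real (card (nsets S 2)) \<le> (real (card S))\<^sup>2 / 2"
    by (simp add: real_choose_two power2_eq_square mult_left_mono)
  have "prob {G. cover_number S K G < (real (card S))\<^sup>2 / (8 * (real k)\<^sup>2)}
      \<le> prob {G. cover_number S K G \<le> expectation (cover_number S K) - t}"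
  proof (intro measure_pmf.finite_measure_mono Collect_mono impI)
    fix G assume "cover_number S K G < (real (card S))\<^sup>2 / (8 * (real k)\<^sup>2)"
    moreover have "(real (card S))\<^sup>2 / (8 * (real k)\<^sup>2) + t = (real (card S))\<^sup>2 / (7 * (real k)\<^sup>2)"
      unfolding t_def using k by (simp add: field_simps)
    ultimately show "cover_number S K G \<le> expectation (cover_number S K) - t"
      using expectation_cover_number_ge[OF S K k p(2) dense overlap] by linarith
  qed simp
  also have "\<dots> \<le> exp (p * l\<^sup>2 * card (nsets S 2) - l * t)"
  proof (rule unit_lipschitz_lower_tail)
    show "nsets S 2 \<subseteq> nsets V 2"
      using S by (rule nsets_mono)
    show "0 \<le> l" "l \<le> 1"
      unfolding l_def using p by (auto simp: divide_simps)
    show "\<bar>cover_number S K (insert e G) - cover_number S K G\<bar> \<le> of_bool (e \<in> nsets S 2)" for e G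
      using fin K k(1) by (rule cover_number_lipschitz)
  qed (use p in auto)
  also have "\<dots> \<le> exp (p * l\<^sup>2 * ((real (card S))\<^sup>2 / 2) - l * t)"
    using p pairs by (intro exp_le_cancel_iff[THEN iffD2] diff_right_mono mult_left_mono) auto
  also have "p * l\<^sup>2 * ((real (card S))\<^sup>2 / 2) - l * t =
      - ((real (card S))\<^sup>2 / (6272 * (real k ^ 4 * p)))"
    unfolding l_def t_def using p k by (simp add: field_simps power2_eq_square power4_eq_xxxx)
  finally show ?thesis .
qed

lemma card_vertex_weightings:
  "card (Pow V \<times> (V \<rightarrow>\<^sub>E {..card V})) = 2 ^ card V * (card V + 1) ^ card V"
  using finite_V by (simp add: card_cartesian_product card_Pow card_PiE)

lemma prob_not_richly_independent_le:
  assumes k: "2 \<le> k" and p: "0 < p" "p \<le> 1 / 2" "1 \<le> (real k)\<^sup>2 * p" and s: "real k \<le> s"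
    and overlap: "\<And>m. s \<le> real m \<Longrightarrow> m \<le> card V \<Longrightarrow>
      (real k)\<^sup>2 * overlap_sum k m (1 / (1 - p)) \<le> 1 / 10"
  shows "prob {G. \<not> richly_independent V k s G} \<le>
    2 ^ card V * real (card V + 1) ^ card V * exp (- (s\<^sup>2 / (6272 * (real k ^ 4 * p))))"
proof -
  define K where "K = (\<lambda>(S :: 'a set, x). heavy_sets S k (\<lambda>v. real (x v :: nat)))"
  define J where "J = {(S, x) \<in> Pow V \<times> (V \<rightarrow>\<^sub>E {..card V}).
    s \<le> real (card S) \<and> card S choose k \<le> 2 * card (K (S, x))}"
  define poor where
    "poor = (\<lambda>j G. cover_number (fst j) (K j) G < (real (card (fst j)))\<^sup>2 / (8 * (real k)\<^sup>2))"
  let ?bound = "exp (- (s\<^sup>2 / (6272 * (real k ^ 4 * p))))"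
  have fin: "finite (Pow V \<times> (V \<rightarrow>\<^sub>E {..card V}))"
    using finite_V by (intro finite_cartesian_product finite_PiE) auto
  have tail: "prob {G. poor (S, x) G} \<le> ?bound" if "(S, x) \<in> J" for S x
  proof -
    have S: "S \<subseteq> V" "s \<le> real (card S)" "card S choose k \<le> 2 * card (K (S, x))"
      using that by (auto simp: J_def)
    have "prob {G. poor (S, x) G} \<le> exp (- ((real (card S))\<^sup>2 / (6272 * (real k ^ 4 * p))))"
      unfolding poor_def fst_conv using S s card_mono[OF finite_V S(1)]
      by (intro cover_number_lower_tail k p overlap) (auto simp: K_def heavy_sets_def)
    also have "\<dots> \<le> ?bound"
      using S s p by (auto intro!: divide_right_mono power_mono)
    finally show ?thesis .
  qed
  have "prob {G. \<not> richly_independent V k s G} \<le> prob {G. \<exists>j\<in>J. poor j G}"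
    by (intro measure_pmf.finite_measure_mono)
      (auto simp: richly_independent_def J_def K_def poor_def Let_def not_le)
  also have "\<dots> \<le> (\<Sum>j\<in>J. ?bound)"
    using tail by (intro prob_bex_le finite_subset[OF _ fin]) (auto simp: J_def)
  also have "\<dots> = real (card J) * ?bound"
    by simp
  also have "card J \<le> 2 ^ card V * (card V + 1) ^ card V"
    using fin unfolding card_vertex_weightings[symmetric] by (intro card_mono) (auto simp: J_def)
  then have "real (card J) \<le> real (2 ^ card V * (card V + 1) ^ card V)"
    by (rule of_nat_mono)
  finally show ?thesis
    by (simp add: mult_right_mono)
qed

lemma edge_count_upper_tail:
  assumes T: "T \<subseteq> V" and a: "p * real (card T) \<le> a / 2"
  shows "prob {G. a * real (card T) \<le> real (edge_count G T)} \<le> exp (- a / 2) ^ card T"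
proof -
  have "prob {G. a * real (card T) \<le> real (edge_count G T)} \<le>
      exp (2 * p * card (nsets T 2) - a * card T)"
    unfolding edge_count_def Int_commute[of _ "nsets T 2"] using p_nonneg p_less_1 nsets_mono[OF T]
    by (intro card_Int_upper_tail) auto
  also have "2 * p * card (nsets T 2) - a * card T \<le> card T * (- a / 2)"
  proof -
    have "2 * p * card (nsets T 2) \<le> p * card T * card T"
      using p_nonneg by (simp add: real_choose_two mult.assoc mult_left_mono)
    also have "\<dots> \<le> a / 2 * card T"
      using a by (rule mult_right_mono) simp
    finally show ?thesis
      by (simp add: algebra_simps)
  qed
  finally show ?thesis
    by (simp add: exp_of_nat_mult[symmetric])
qed

lemma prob_not_locally_sparse_le:
  assumes a: "p * s \<le> a / 2"
  shows "prob {G. \<not> locally_sparse V s a G} \<le> (1 + exp (- a / 2)) ^ card V - 1"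
proof -
  define J where "J = {T \<in> Pow V - {{}}. real (card T) \<le> s}"
  have fin: "finite (Pow V - {{}})"
    using finite_V by simp
  have tail: "prob {G. a * real (card T) \<le> real (edge_count G T)} \<le> exp (- a / 2) ^ card T"
    if "T \<in> J" for T
  proof (rule edge_count_upper_tail)
    have "p * card T \<le> p * s"
      using that p_nonneg by (intro mult_left_mono) (auto simp: J_def)
    then show "p * card T \<le> a / 2"
      using a by linarith
  qed (use that in \<open>auto simp: J_def\<close>)
  have "prob {G. \<not> locally_sparse V s a G} \<le>
      prob {G. \<exists>T\<in>J. a * real (card T) \<le> real (edge_count G T)}"
  proof (intro measure_pmf.finite_measure_mono Collect_mono impI)
    fix G assume "\<not> locally_sparse V s a G"
    then obtain T where T: "T \<subseteq> V" "real (card T) \<le> s" "a * real (card T) < real (edge_count G T)"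
      by (auto simp: locally_sparse_def not_le)
    then have "T \<noteq> {}"
      by (auto simp: edge_count_def nsets_empty_iff)
    with T show "\<exists>T\<in>J. a * card T \<le> edge_count G T"
      by (intro bexI[of _ T]) (auto simp: J_def)
  qed simp
  also have "\<dots> \<le> (\<Sum>T\<in>J. exp (- a / 2) ^ card T)"
    using tail by (intro prob_bex_le finite_subset[OF _ fin]) (auto simp: J_def)
  also have "\<dots> \<le> (\<Sum>T\<in>Pow V - {{}}. exp (- a / 2) ^ card T)"
    using fin by (intro sum_mono2) (auto simp: J_def)
  also have "\<dots> = (1 + exp (- a / 2)) ^ card V - 1"
    using finite_V by (simp add: sum_diff1 sum_power_card_Pow)
  finally show ?thesis .
qed

end

section \<open>Colouring graphs with few edges\<close>

lemma edge_count_mono: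
  assumes "finite T" "S \<subseteq> T"
  shows "edge_count E S \<le> edge_count E T"
  unfolding edge_count_def using nsets_mono[OF assms(2), of 2] finite_imp_finite_nsets[OF assms(1)]
  by (intro card_mono) auto

lemma edge_count_Un_le: "edge_count (G \<union> E) T \<le> edge_count G T + edge_count E T"
  unfolding edge_count_def Int_Un_distrib2 by (rule card_Un_le)

lemma edge_count_eq_card: "E \<subseteq> nsets V 2 \<Longrightarrow> edge_count E V = card E"
  by (simp add: edge_count_def Int_absorb2)

definition degree_in :: "'a set set \<Rightarrow> 'a set \<Rightarrow> 'a \<Rightarrow> nat" where
  "degree_in E S v = card {e \<in> E \<inter> nsets S 2. v \<in> e}"

lemma degree_in_mono:
  assumes "finite T" "S \<subseteq> T"
  shows "degree_in E S v \<le> degree_in E T v"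
  unfolding degree_in_def using nsets_mono[OF assms(2), of 2] finite_imp_finite_nsets[OF assms(1)]
  by (intro card_mono) auto

lemma sum_degree_in:
  assumes "finite S" "finite I"
  shows "(\<Sum>v\<in>I. degree_in E S v) = (\<Sum>e\<in>E \<inter> nsets S 2. card (e \<inter> I))"
  unfolding degree_in_def
  by (rule sum_multicount_gen)
    (use assms in \<open>auto simp: finite_imp_finite_nsets Int_def conj_commute
        intro!: arg_cong[where f = card]\<close>)

lemma handshake:
  assumes "finite S"
  shows "(\<Sum>v\<in>S. degree_in E S v) = 2 * edge_count E S"
proof -
  have "(\<Sum>v\<in>S. degree_in E S v) = (\<Sum>e\<in>E \<inter> nsets S 2. 2)"
    unfolding sum_degree_in[OF assms assms]
    by (intro sum.cong refl) (auto simp: nsets_def Int_absorb2)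
  then show ?thesis
    by (simp add: edge_count_def)
qed

lemma edge_count_Diff_le:
  assumes "finite S" "I \<subseteq> S"
  shows "(\<Sum>v\<in>I. degree_in E S v) + edge_count E (S - I) \<le> edge_count E S + edge_count E I"
proof -
  define M where "M = E \<inter> nsets S 2"
  have fin: "finite M" "finite I"
    using assms finite_imp_finite_nsets finite_subset by (auto simp: M_def)
  have inside: "edge_count E T = (\<Sum>e\<in>M. of_bool (e \<subseteq> T))" if "T \<subseteq> S" for T
  proof -
    have "E \<inter> nsets T 2 = M \<inter> {e. e \<subseteq> T}"
      using that by (auto simp: M_def nsets_def)
    then show ?thesis
      using fin by (simp add: edge_count_def)
  qed
  have "(\<Sum>v\<in>I. degree_in E S v) + edge_count E (S - I) = (\<Sum>e\<in>M. card (e \<inter> I) + of_bool (e \<subseteq> S - I))"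
    unfolding inside[OF Diff_subset] sum_degree_in[OF assms(1) fin(2)]
    by (simp add: sum.distrib M_def)
  also have "\<dots> \<le> (\<Sum>e\<in>M. 1 + of_bool (e \<subseteq> I))"
  proof (rule sum_mono)
    fix e assume "e \<in> M"
    then obtain u v where e: "e = {u, v}" "u \<noteq> v" "u \<in> S" "v \<in> S"
      by (auto simp: M_def elim: nsets2_E)
    then show "card (e \<inter> I) + of_bool (e \<subseteq> S - I) \<le> 1 + of_bool (e \<subseteq> I)"
      by (cases "u \<in> I"; cases "v \<in> I") auto
  qed
  also have "\<dots> = edge_count E S + edge_count E I"
    unfolding inside[OF assms(2)] sum.distrib by (simp add: edge_count_def M_def)
  finally show ?thesis .
qed

lemma edge_count_le_sqrt:
  assumes "finite T" "real (edge_count E T) \<le> M"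
  shows "2 * real (edge_count E T) \<le> sqrt (2 * M) * real (card T)"
proof -
  define m where "m = real (edge_count E T)"
  have "edge_count E T \<le> card (nsets T 2)"
    unfolding edge_count_def using assms(1) by (intro card_mono finite_imp_finite_nsets) auto
  then have "m \<le> real (card T choose 2)"
    by (simp add: m_def)
  then have "2 * m \<le> (real (card T))\<^sup>2"
    by (simp add: real_choose_two power2_eq_square algebra_simps)
  then have "(2 * m)\<^sup>2 \<le> 2 * M * (real (card T))\<^sup>2"
    unfolding power2_eq_square[of "2 * m"] using assms(2) by (intro mult_mono) (auto simp: m_def)
  then have "2 * m \<le> sqrt (2 * M * (real (card T))\<^sup>2)"
    by (rule real_le_rsqrt)
  then show ?thesis
    by (simp add: real_sqrt_mult m_def)
qed

lemma card_neighbours_le_degree_in: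
  assumes "finite T" "v \<in> T" "{v} \<notin> H"
  shows "card {u \<in> T. {u, v} \<in> H} \<le> degree_in H T v"
  unfolding degree_in_def
proof (rule card_inj_on_le[where f = "\<lambda>u. {u, v}"])
  show "(\<lambda>u. {u, v}) ` {u \<in> T. {u, v} \<in> H} \<subseteq> {e \<in> H \<inter> nsets T 2. v \<in> e}"
    using assms by auto
qed (use finite_imp_finite_nsets[OF assms(1)] in \<open>auto simp: inj_on_def doubleton_eq_iff\<close>)

lemma ex_degree_in_le_average:
  assumes "finite T" "T \<noteq> {}" "2 * real (edge_count H T) \<le> d * real (card T)"
  shows "\<exists>v\<in>T. real (degree_in H T v) \<le> d"
proof (rule ccontr)
  assume "\<not> ?thesis"
  then have "d * real (card T) < (\<Sum>v\<in>T. real (degree_in H T v))"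
    using assms(1,2) sum_strict_mono[of T "\<lambda>_. d" "\<lambda>v. real (degree_in H T v)"]
    by (simp add: not_le mult.commute)
  also have "\<dots> = 2 * real (edge_count H T)"
    using handshake[OF assms(1), of H] by (simp flip: of_nat_sum)
  finally show False
    using assms(3) by simp
qed

definition colourable :: "'a set \<Rightarrow> 'a set set \<Rightarrow> nat \<Rightarrow> bool" where
  "colourable V H q \<longleftrightarrow> (\<exists>c. proper_colouring V H q c)"

lemma chromatic_number_le: "colourable V H q \<Longrightarrow> chromatic_number V H \<le> q"
  unfolding colourable_def chromatic_number_def by (rule Least_le)

lemma colourable_Un:
  assumes "colourable S H a" "colourable T H b"
  shows "colourable (S \<union> T) H (a + b)"
proof -
  obtain c d where c: "proper_colouring S H a c" and d: "proper_colouring T H b d"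
    using assms by (auto simp: colourable_def)
  have "proper_colouring (S \<union> T) H (a + b) (\<lambda>v. if v \<in> S then c v else a + d v)"
    using c d unfolding proper_colouring_def Pi_def by (auto simp: trans_less_add1 insert_commute)
  then show ?thesis
    by (auto simp: colourable_def)
qed

lemma colourable_card:
  assumes "finite S" "\<And>v. v \<in> S \<Longrightarrow> {v} \<notin> H"
  shows "colourable S H (card S)"
proof -
  obtain f where f: "bij_betw f S {0..<card S}"
    using ex_bij_betw_finite_nat[OF assms(1)] by blast
  have "proper_colouring S H (card S) f"
    unfolding proper_colouring_def
  proof (intro conjI ballI impI)
    show "f \<in> S \<rightarrow> {..<card S}"
      using bij_betwE[OF f] by auto
    fix u v assume "u \<in> S" "v \<in> S" "{u, v} \<in> H"
    moreover from this have "u \<noteq> v"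
      using assms(2) by auto
    ultimately show "f u \<noteq> f v"
      using inj_onD[OF bij_betw_imp_inj_on[OF f]] by blast
  qed
  then show ?thesis
    by (auto simp: colourable_def)
qed

lemma proper_colouring_extend:
  assumes c: "proper_colouring (S - {v}) H k c" and q: "q < k" "\<And>u. u \<in> S \<Longrightarrow> {u, v} \<in> H \<Longrightarrow> c u \<noteq> q"
    and loop: "{v} \<notin> H"
  shows "proper_colouring S H k (c(v := q))"
  unfolding proper_colouring_def
proof (intro conjI ballI impI)
  show "c(v := q) \<in> S \<rightarrow> {..<k}"
    using c q unfolding proper_colouring_def by auto
  fix u w assume uw: "u \<in> S" "w \<in> S" "{u, w} \<in> H"
  then have "\<not> (u = v \<and> w = v)"
    using loop by auto
  then show "(c(v := q)) u \<noteq> (c(v := q)) w"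
    using c q(2)[of u] q(2)[of w] uw unfolding proper_colouring_def by (auto simp: insert_commute)
qed

lemma colourable_degenerate:
  assumes "finite S" and "\<And>v. v \<in> S \<Longrightarrow> {v} \<notin> H"
    and "\<And>T. T \<subseteq> S \<Longrightarrow> T \<noteq> {} \<Longrightarrow> \<exists>v\<in>T. card {u \<in> T. {u, v} \<in> H} \<le> d"
  shows "colourable S H (Suc d)"
  using assms
proof (induction S rule: finite_psubset_induct)
  case (psubset S)
  show ?case
  proof (cases "S = {}")
    case True
    then show ?thesis
      by (auto simp: colourable_def proper_colouring_def)
  next
    case False
    then obtain v where v: "v \<in> S" "card {u \<in> S. {u, v} \<in> H} \<le> d"
      using psubset.prems(2)[of S] by auto
    have "colourable (S - {v}) H (Suc d)"
    proof (rule psubset.IH)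
      show "\<exists>w\<in>T. card {u \<in> T. {u, w} \<in> H} \<le> d" if "T \<subseteq> S - {v}" "T \<noteq> {}" for T
        using that by (intro psubset.prems(2)) auto
    qed (use v psubset.prems(1) in auto)
    then obtain c where c: "proper_colouring (S - {v}) H (Suc d) c"
      by (auto simp: colourable_def)
    define N where "N = {u \<in> S. {u, v} \<in> H}"
    have fin: "finite N"
      using psubset.hyps by (simp add: N_def)
    have "card (c ` N) < card {..d}"
      using card_image_le[OF fin, of c] v(2) by (simp add: N_def)
    then have "\<not> {..d} \<subseteq> c ` N"
      using card_mono[OF finite_imageI[OF fin], of "{..d}" c] by linarith
    then obtain q where "q \<le> d" "q \<notin> c ` N"
      by auto
    then have "proper_colouring S H (Suc d) (c(v := q))"
      using c psubset.prems(1)[OF v(1)] by (intro proper_colouring_extend) (auto simp: N_def)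
    then show ?thesis
      by (auto simp: colourable_def)
  qed
qed

lemma colourable_sparse:
  assumes S: "finite S" "\<And>v. v \<in> S \<Longrightarrow> {v} \<notin> H" and d: "d \<ge> 0"
    and sparse: "\<And>T. T \<subseteq> S \<Longrightarrow> 2 * real (edge_count H T) \<le> d * real (card T)"
  shows "colourable S H (nat \<lfloor>d\<rfloor> + 1)"
proof -
  have "colourable S H (Suc (nat \<lfloor>d\<rfloor>))"
  proof (rule colourable_degenerate[OF S])
    fix T assume T: "T \<subseteq> S" "T \<noteq> {}"
    then have fin: "finite T"
      using S(1) finite_subset by blast
    obtain v where v: "v \<in> T" "real (degree_in H T v) \<le> d"
      using ex_degree_in_le_average[OF fin T(2) sparse[OF T(1)]] by blast
    have "card {u \<in> T. {u, v} \<in> H} \<le> degree_in H T v"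
      using fin v(1) S(2) T(1) by (intro card_neighbours_le_degree_in) auto
    also have "\<dots> \<le> nat \<lfloor>d\<rfloor>"
      using v(2) by (simp add: le_nat_floor)
    finally show "\<exists>v\<in>T. card {u \<in> T. {u, v} \<in> H} \<le> nat \<lfloor>d\<rfloor>"
      using v(1) by blast
  qed
  then show ?thesis by simp
qed

lemma colourable_few_edges:
  assumes S: "finite S" "\<And>v. v \<in> S \<Longrightarrow> {v} \<notin> H" and M: "real (edge_count H S) \<le> M"
  shows "colourable S H (nat \<lfloor>sqrt (2 * M)\<rfloor> + 1)"
proof (rule colourable_sparse[OF S])
  show "0 \<le> sqrt (2 * M)"
    using order_trans[OF of_nat_0_le_iff M] by simp
  show "2 * real (edge_count H T) \<le> sqrt (2 * M) * real (card T)" if "T \<subseteq> S" for T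
    using edge_count_mono[OF S(1) that, of H] finite_subset[OF that S(1)] M
    by (intro edge_count_le_sqrt) auto
qed

section \<open>Greedy colouring of pseudorandom graphs with additional edges\<close>

lemma heavy_sets_cong:
  assumes "\<And>v. v \<in> S \<Longrightarrow> x v = y v"
  shows "heavy_sets S k x = heavy_sets S k y"
proof -
  have "sum x I = sum y I" if "I \<subseteq> S" for I
    using assms that by (intro sum.cong) auto
  then show ?thesis
    unfolding heavy_sets_def by (intro Collect_cong conj_cong) (auto simp: nsets_def)
qed

lemma degree_in_le_card:
  assumes "finite S"
  shows "degree_in E S v \<le> card S"
proof -
  have "{e \<in> E \<inter> nsets S 2. v \<in> e} \<subseteq> (\<lambda>u. {u, v}) ` S"
    by (auto elim!: nsets2_E)
  then show ?thesis
    unfolding degree_in_def using assms by (meson card_image_le card_mono finite_imageI order_trans)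
qed

lemma sqrt_diff_ge:
  fixes l k :: real
  assumes "0 < l" "0 \<le> k" "k \<le> l"
  shows "k / (2 * sqrt l) \<le> sqrt l - sqrt (l - k)"
proof -
  have "k = (sqrt l - sqrt (l - k)) * (sqrt l + sqrt (l - k))"
    using assms by (simp add: algebra_simps)
  also have "\<dots> \<le> (sqrt l - sqrt (l - k)) * (2 * sqrt l)"
    using assms by (intro mult_left_mono) auto
  finally show ?thesis
    using assms by (simp add: divide_le_eq)
qed

locale pseudorandom_graph =
  fixes V :: "'a set" and G :: "'a set set" and k :: nat and s a :: real
  assumes finite_V: "finite V" and G_subset: "G \<subseteq> nsets V 2"
    and rich: "richly_independent V k s G" and sparse: "locally_sparse V s a G"
    and k_ge_2: "2 \<le> k" and s_ge: "40 * real k \<le> s" and a_nonneg: "0 \<le> a"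
begin

definition light_class :: "'a set set \<Rightarrow> 'a set \<Rightarrow> 'a set \<Rightarrow> bool" where
  "light_class E S I \<longleftrightarrow> I \<in> nsets S k \<and> indep I G \<and>
     real (edge_count E I) \<le> 8 * (real k)\<^sup>2 * real (edge_count E S) / (real (card S))\<^sup>2"

lemma light_classD:
  assumes "light_class E S I"
  shows "I \<subseteq> S" "finite I" "card I = k" "indep I G"
    "real (edge_count E I) \<le> 8 * (real k)\<^sup>2 * real (edge_count E S) / (real (card S))\<^sup>2"
  using assms by (auto simp: light_class_def nsets_def)

lemma light_heavy_class_exists:
  fixes x :: "'a \<Rightarrow> nat"
  assumes S: "S \<subseteq> V" "s \<le> real (card S)" and x: "\<And>v. v \<in> S \<Longrightarrow> x v \<le> card V"
    and dense: "card S choose k \<le> 2 * card (heavy_sets S k (\<lambda>v. real (x v)))"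
  shows "\<exists>I. light_class E S I \<and> I \<in> heavy_sets S k (\<lambda>v. real (x v))"
proof -
  define y where "y = (\<lambda>v\<in>V. if v \<in> S then x v else 0)"
  have y: "y \<in> V \<rightarrow>\<^sub>E {..card V}"
    using x by (auto simp: y_def)
  have eq: "heavy_sets S k (\<lambda>v. real (y v)) = heavy_sets S k (\<lambda>v. real (x v))"
    using S(1) by (intro heavy_sets_cong) (auto simp: y_def)
  have "\<exists>I\<in>heavy_sets S k (\<lambda>v. real (x v)). indep I G \<and>
      real (edge_count E I) \<le> 8 * (real k)\<^sup>2 * real (edge_count E S) / (real (card S))\<^sup>2"
  proof (rule indep_set_few_edges)
    show "finite S"
      using S(1) finite_V by (rule finite_subset)
    show "card S > 0"
      using S(2) s_ge k_ge_2 by (cases "card S = 0") auto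
    show "(real (card S))\<^sup>2 / (8 * (real k)\<^sup>2) \<le> cover_number S (heavy_sets S k (\<lambda>v. real (x v))) G"
      using rich y S dense unfolding richly_independent_def Let_def eq[symmetric] by blast
  qed (use k_ge_2 heavy_sets_subset in auto)
  then show ?thesis
    using heavy_sets_subset by (fastforce simp: light_class_def)
qed

lemma light_class_exists:
  assumes S: "S \<subseteq> V" "s \<le> real (card S)"
  shows "\<exists>I. light_class E S I"
proof -
  have "heavy_sets S k (\<lambda>_. 0) = nsets S k"
    by (auto simp: heavy_sets_def)
  then show ?thesis
    using light_heavy_class_exists[OF S, of "\<lambda>_. 0"] by auto
qed

text \<open>Weighting the vertices by their degree makes the removed class carry its fair share of the
  edges, so that the remaining edges decrease in proportion to the remaining vertices.\<close>

lemma proportional_light_class_exists: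
  assumes S: "S \<subseteq> V" "s \<le> real (card S)"
    and degree: "\<And>v. v \<in> S \<Longrightarrow> real (degree_in E S v) \<le> D"
    and many: "25 / 4 * D * real (card S) \<le> real k * real (edge_count E S)"
  shows "\<exists>I. light_class E S I \<and>
    real (edge_count E (S - I)) \<le> real (edge_count E S) / real (card S) * (real (card S) - real k)"
proof -
  define l where "l = real (card S)"
  define m where "m = real (edge_count E S)"
  define x where "x = (\<lambda>v. real (degree_in E S v))"
  have fin: "finite S"
    using S(1) finite_V by (rule finite_subset)
  have l: "40 * real k \<le> l" "0 < l" and k: "2 \<le> k" "k \<le> card S"
    using S(2) s_ge k_ge_2 by (auto simp: l_def)
  have sum_x: "sum x S = 2 * m"
    using handshake[OF fin, of E] by (simp add: x_def m_def flip: of_nat_sum)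
  have "25 / 2 * D \<le> real k / real (card S) * sum x S"
    using many l unfolding sum_x by (simp add: l_def[symmetric] m_def[symmetric] field_simps)
  then have "card S choose k \<le> 2 * card (heavy_sets S k x)"
    using degree by (intro heavy_sets_dense[OF fin k]) (auto simp: x_def)
  then obtain I where I: "light_class E S I" "I \<in> heavy_sets S k x"
    using light_heavy_class_exists[OF S, of "degree_in E S"] degree_in_le_card[OF fin, of E]
      card_mono[OF finite_V S(1)] by (auto simp: x_def intro: order_trans)
  have share: "6 / 5 * (real k * m / l) \<le> sum x I"
    using I(2) unfolding heavy_sets_def sum_x by (simp add: l_def)
  have "real (edge_count E I) \<le> 8 * real k / l * (real k * m / l)"
    using light_classD(5)[OF I(1)] by (simp add: l_def m_def power2_eq_square)
  also have "\<dots> \<le> 1 / 5 * (real k * m / l)"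
    using l by (intro mult_right_mono) (auto simp: m_def divide_le_eq)
  finally have inside: "real (edge_count E I) \<le> 1 / 5 * (real k * m / l)" .
  have "sum x I + real (edge_count E (S - I)) \<le> m + real (edge_count E I)"
    using edge_count_Diff_le[OF fin light_classD(1)[OF I(1)], of E]
    by (simp add: x_def m_def flip: of_nat_sum of_nat_add)
  then have "real (edge_count E (S - I)) \<le> m - real k * m / l"
    using share inside by linarith
  also have "\<dots> = m / l * (l - real k)"
    using l by (simp add: field_simps)
  finally show ?thesis
    using I(1) by (auto simp: m_def l_def)
qed

lemma light_class_step:
  assumes S: "S \<subseteq> V" "s \<le> real (card S)"
    and degree: "\<And>v. v \<in> S \<Longrightarrow> real (degree_in E S v) \<le> D" and B: "7 * D \<le> B * real k" "0 \<le> B"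
  obtains I where "light_class E S I"
    "real (edge_count E S) \<le> B * real (card S) \<Longrightarrow>
      real (edge_count E (S - I)) \<le> B * (real (card S) - real k)"
proof (cases "25 / 4 * D * real (card S) \<le> real k * real (edge_count E S)")
  case True
  then obtain I where I: "light_class E S I"
    "real (edge_count E (S - I)) \<le> real (edge_count E S) / real (card S) * (real (card S) - real k)"
    using proportional_light_class_exists[OF S degree] by blast
  have "real (edge_count E S) / real (card S) * (real (card S) - real k)
      \<le> B * (real (card S) - real k)"
    if "real (edge_count E S) \<le> B * real (card S)"
    using that S s_ge k_ge_2 by (intro mult_right_mono) (auto simp: divide_le_eq)
  with I show ?thesis
    by (intro that[of I]) auto
next
  case False
  obtain I where I: "light_class E S I"
    using light_class_exists[OF S] by blast
  have "real k * real (edge_count E S) \<le> 25 / 28 * real (card S) * (7 * D)"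
    using False by simp
  also have "\<dots> \<le> 25 / 28 * real (card S) * (B * real k)"
    using B by (intro mult_left_mono) auto
  also have "\<dots> = real k * (25 / 28 * real (card S) * B)"
    by simp
  finally have "real (edge_count E S) \<le> 25 / 28 * real (card S) * B"
    using k_ge_2 by (subst (asm) mult_le_cancel_left_pos) auto
  also have "\<dots> \<le> (real (card S) - real k) * B"
    using S s_ge B by (intro mult_right_mono) auto
  finally have "real (edge_count E (S - I)) \<le> B * (real (card S) - real k)"
    using edge_count_mono[OF finite_subset[OF S(1) finite_V] Diff_subset, of E I]
    by (simp add: mult.commute)
  with I show ?thesis
    by (intro that[of I]) auto
qed

end

locale augmented_pseudorandom_graph = pseudorandom_graph +
  fixes E :: "'a set set" and u :: real
  assumes E_subset: "E \<subseteq> nsets V 2" and card_E: "real (card E) \<le> u\<^sup>2"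
    and u_ge_1: "1 \<le> u" and u_le: "16 * u \<le> real (card V)"
begin

definition edge_density :: real where
  "edge_density = max (7 * u / (4 * real k)) (2 * u\<^sup>2 / real (card V))"

text \<open>As \<open>8 < 3\<^sup>2\<close>, the light classes of a set with at least this many vertices contain no edge
  of \<open>E\<close>.\<close>

definition threshold :: real where
  "threshold = 3 * real k * u"

definition admissible :: "'a set \<Rightarrow> bool" where
  "admissible S \<longleftrightarrow> S \<subseteq> V \<and> (\<forall>v\<in>S. real (degree_in E S v) \<le> u / 4) \<and>
     (threshold \<le> real (card S) \<or> real (edge_count E S) \<le> edge_density * real (card S))"

text \<open>Bounds the colours beyond one per class that the last \<open>l\<close> vertices need: those of a single
  class amount to a difference of square roots, so the sum telescopes.\<close>

definition surplus :: "real \<Rightarrow> real" where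
  "surplus l = 8 * sqrt edge_density * sqrt (min l threshold)"

lemma edge_density_ge: "7 * u / 4 \<le> edge_density * real k" "2 * u\<^sup>2 \<le> edge_density * real (card V)"
proof -
  have "7 * u / (4 * real k) \<le> edge_density" "2 * u\<^sup>2 / real (card V) \<le> edge_density"
    by (simp_all add: edge_density_def)
  then show "7 * u / 4 \<le> edge_density * real k" "2 * u\<^sup>2 \<le> edge_density * real (card V)"
    using k_ge_2 u_ge_1 u_le by (simp_all add: divide_le_eq)
qed

lemma edge_density_nonneg: "0 \<le> edge_density"
  using u_ge_1 by (simp add: edge_density_def max.coboundedI1)

lemma edge_count_le: "S \<subseteq> V \<Longrightarrow> real (edge_count E S) \<le> u\<^sup>2"
  using edge_count_mono[OF finite_V, of S E] card_E by (simp add: edge_count_eq_card[OF E_subset])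

lemma u_squared_le_edge_density_threshold: "u\<^sup>2 \<le> edge_density * (threshold - real k)"
proof -
  have "u\<^sup>2 \<le> 7 * u / 4 * (3 * u - 1)"
    using mult_mono[of 1 u 1 u] u_ge_1 by (simp add: power2_eq_square algebra_simps)
  also have "\<dots> \<le> edge_density * real k * (3 * u - 1)"
    using edge_density_ge(1) u_ge_1 by (intro mult_right_mono) auto
  finally show ?thesis
    by (simp add: threshold_def algebra_simps)
qed

lemma surplus_card_V_le: "surplus (real (card V)) \<le> 92 / 5 * u"
proof -
  have "edge_density * min (real (card V)) threshold \<le> (23 / 10 * u)\<^sup>2"
  proof (cases "7 * u / (4 * real k) \<le> 2 * u\<^sup>2 / real (card V)")
    case True
    have "edge_density * min (real (card V)) threshold \<le> 2 * u\<^sup>2 / real (card V) * real (card V)"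
      unfolding edge_density_def max_absorb2[OF True] by (intro mult_left_mono) auto
    also have "\<dots> \<le> (23 / 10 * u)\<^sup>2"
      by (simp add: power_mult_distrib power_divide)
    finally show ?thesis .
  next
    case False
    then have le: "2 * u\<^sup>2 / real (card V) \<le> 7 * u / (4 * real k)"
      by simp
    have "edge_density * min (real (card V)) threshold \<le> 7 * u / (4 * real k) * threshold"
      unfolding edge_density_def max_absorb1[OF le] using u_ge_1 by (intro mult_left_mono) auto
    also have "\<dots> \<le> (23 / 10 * u)\<^sup>2"
      using k_ge_2 by (simp add: threshold_def power2_eq_square mult_right_mono)
    finally show ?thesis .
  qed
  then have "sqrt (edge_density * min (real (card V)) threshold) \<le> 23 / 10 * u"
    using u_ge_1 by (intro real_le_lsqrt) auto
  then show ?thesis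
    by (simp add: surplus_def real_sqrt_mult)
qed

lemma no_loops: "{v} \<notin> G \<union> E"
  using G_subset E_subset by (auto simp: nsets_def)

lemma edge_count_light_class:
  assumes "light_class E S I"
  shows "edge_count (G \<union> E) I = edge_count E I"
proof -
  have "(G \<union> E) \<inter> nsets I 2 = E \<inter> nsets I 2"
    using light_classD(4)[OF assms] unfolding indep_iff_disjoint_nsets by auto
  then show ?thesis
    by (simp add: edge_count_def)
qed

lemma small_set_colourable:
  assumes S: "S \<subseteq> V" "real (card S) < s"
  shows "colourable S (G \<union> E) (nat \<lfloor>2 * a + 3 / 2 * u\<rfloor> + 1)"
proof (rule colourable_sparse)
  show fin: "finite S"
    using S(1) finite_V by (rule finite_subset)
  show "0 \<le> 2 * a + 3 / 2 * u"
    using a_nonneg u_ge_1 by simp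
  fix T assume T: "T \<subseteq> S"
  have "real (edge_count G T) \<le> a * real (card T)"
    using sparse T S card_mono[OF fin T] by (auto simp: locally_sparse_def)
  moreover have "2 * real (edge_count E T) \<le> sqrt (2 * u\<^sup>2) * real (card T)"
    using T S fin by (intro edge_count_le_sqrt edge_count_le) (auto intro: finite_subset)
  moreover have "sqrt (2 * u\<^sup>2) \<le> 3 / 2 * u"
    using u_ge_1 by (intro real_le_lsqrt) (auto simp: power_mult_distrib power2_eq_square)
  then have "sqrt (2 * u\<^sup>2) * real (card T) \<le> 3 / 2 * u * real (card T)"
    by (rule mult_right_mono) simp
  ultimately show "2 * real (edge_count (G \<union> E) T) \<le> (2 * a + 3 / 2 * u) * real (card T)"
    using edge_count_Un_le[of G E T] by (simp add: algebra_simps)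
qed (rule no_loops)

lemma light_class_colourable_above_threshold:
  assumes S: "S \<subseteq> V" "threshold \<le> real (card S)" and I: "light_class E S I"
  shows "colourable I (G \<union> E) 1"
proof -
  have "real (edge_count E I) \<le> 8 * (real k)\<^sup>2 * real (edge_count E S) / (real (card S))\<^sup>2"
    by (rule light_classD[OF I])
  also have "\<dots> \<le> 8 * (real k)\<^sup>2 * u\<^sup>2 / threshold\<^sup>2"
    using S(2) u_ge_1 k_ge_2 edge_count_le[OF S(1)]
    by (intro frac_le mult_left_mono power_mono) (auto simp: threshold_def)
  also have "\<dots> < 1"
    using u_ge_1 k_ge_2 by (simp add: threshold_def power_mult_distrib)
  finally have "real (edge_count (G \<union> E) I) \<le> 0"
    by (simp add: edge_count_light_class[OF I])
  from colourable_few_edges[OF light_classD(2)[OF I] no_loops this] show ?thesis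
    by simp
qed

lemma light_class_colourable_sparse:
  assumes S: "40 * real k \<le> real (card S)" and I: "light_class E S I"
    and edges: "real (edge_count E S) \<le> edge_density * real (card S)"
  shows "\<exists>q. colourable I (G \<union> E) q \<and>
    real q \<le> 1 + 8 * sqrt edge_density * (sqrt (real (card S)) - sqrt (real (card S) - real k))"
proof -
  define l where "l = real (card S)"
  define M where "M = 8 * (real k)\<^sup>2 * real (edge_count E S) / l\<^sup>2"
  have l: "0 < l" "real k \<le> l"
    using S k_ge_2 by (auto simp: l_def)
  have "real (edge_count (G \<union> E) I) \<le> M"
    unfolding edge_count_light_class[OF I] M_def l_def by (rule light_classD[OF I])
  from colourable_few_edges[OF light_classD(2)[OF I] no_loops this]
  have col: "colourable I (G \<union> E) (nat \<lfloor>sqrt (2 * M)\<rfloor> + 1)" .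
  have "2 * M \<le> 16 * (real k)\<^sup>2 * (edge_density * l) / l\<^sup>2"
    unfolding M_def using edges by (simp add: l_def divide_right_mono mult_left_mono)
  also have "\<dots> = (4 * sqrt edge_density * real k / sqrt l)\<^sup>2"
    using l edge_density_nonneg by (simp add: power_divide power_mult_distrib power2_eq_square)
  finally have "sqrt (2 * M) \<le> 4 * sqrt edge_density * real k / sqrt l"
    by (rule real_le_lsqrt[rotated]) (use edge_density_nonneg l in auto)
  also have "\<dots> = 8 * sqrt edge_density * (real k / (2 * sqrt l))"
    by simp
  also have "\<dots> \<le> 8 * sqrt edge_density * (sqrt l - sqrt (l - real k))"
    using edge_density_nonneg l by (intro mult_left_mono sqrt_diff_ge) auto
  finally have "real (nat \<lfloor>sqrt (2 * M)\<rfloor> + 1) \<le>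
      1 + 8 * sqrt edge_density * (sqrt l - sqrt (l - real k))"
    by (simp add: M_def l_def) linarith
  with col show ?thesis
    unfolding l_def by blast
qed

lemma light_class_colourable:
  assumes "admissible S" and S: "40 * real k \<le> real (card S)" and I: "light_class E S I"
  shows "\<exists>q. colourable I (G \<union> E) q \<and>
    real q + surplus (real (card S) - real k) \<le> 1 + surplus (real (card S))"
proof (cases "threshold \<le> real (card S)")
  case True
  have "surplus (real (card S) - real k) \<le> surplus (real (card S))"
    unfolding surplus_def using edge_density_nonneg by (intro mult_left_mono real_sqrt_le_mono) auto
  then show ?thesis
    using light_class_colourable_above_threshold[OF _ True I] assms(1)
    by (intro exI[of _ 1]) (auto simp: admissible_def)
next
  case False
  then obtain q where q: "colourable I (G \<union> E) q"
    "real q \<le> 1 + 8 * sqrt edge_density * (sqrt (real (card S)) - sqrt (real (card S) - real k))"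
    using light_class_colourable_sparse[OF S I] assms(1) by (auto simp: admissible_def)
  have "surplus (real (card S) - real k) = 8 * sqrt edge_density * sqrt (real (card S) - real k)"
    "surplus (real (card S)) = 8 * sqrt edge_density * sqrt (real (card S))"
    using False by (simp_all add: surplus_def min_def)
  then show ?thesis
    using q by (intro exI[of _ q]) (simp add: algebra_simps)
qed

lemma admissible_Diff:
  assumes S: "admissible S" and I: "light_class E S I"
    and edges: "real (edge_count E S) \<le> edge_density * real (card S) \<Longrightarrow>
      real (edge_count E (S - I)) \<le> edge_density * (real (card S) - real k)"
  shows "admissible (S - I)"
proof -
  have SV: "S \<subseteq> V" and fin: "finite S"
    using S finite_V finite_subset by (auto simp: admissible_def)
  have card_Diff: "real (card (S - I)) = real (card S) - real k"
    using light_classD(1-3)[OF I] card_mono[OF fin light_classD(1)[OF I]]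
    by (simp add: card_Diff_subset of_nat_diff)
  have "real (edge_count E (S - I)) \<le> edge_density * real (card (S - I))"
  proof (cases "threshold \<le> real (card S)")
    case True
    have "real (edge_count E (S - I)) \<le> u\<^sup>2"
      using SV by (intro edge_count_le) auto
    also have "\<dots> \<le> edge_density * (threshold - real k)"
      by (rule u_squared_le_edge_density_threshold)
    also have "\<dots> \<le> edge_density * real (card (S - I))"
      unfolding card_Diff using True edge_density_nonneg by (intro mult_left_mono) auto
    finally show ?thesis .
  next
    case False
    then show ?thesis
      unfolding card_Diff using S by (intro edges) (auto simp: admissible_def)
  qed
  moreover have "real (degree_in E (S - I) v) \<le> u / 4" if "v \<in> S - I" for v
    using S that degree_in_mono[OF fin Diff_subset, of E I v] by (force simp: admissible_def)
  ultimately show ?thesis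
    using SV by (auto simp: admissible_def)
qed

definition colour_bound :: "real \<Rightarrow> real" where
  "colour_bound l = 2 * a + 3 / 2 * u + 1 + l / real k + surplus l"

lemma colour_bound_ge:
  assumes "0 \<le> l"
  shows "real (nat \<lfloor>2 * a + 3 / 2 * u\<rfloor> + 1) \<le> colour_bound l"
proof -
  have "0 \<le> surplus l"
    using assms edge_density_nonneg u_ge_1 by (simp add: surplus_def threshold_def)
  then show ?thesis
    using assms a_nonneg u_ge_1 by (simp add: colour_bound_def add_increasing2)
qed

lemma greedy_step:
  assumes S: "admissible S" "s \<le> real (card S)"
  obtains I q where "light_class E S I" "admissible (S - I)" "colourable I (G \<union> E) q"
    "real q + colour_bound (real (card S) - real k) \<le> colour_bound (real (card S))"
proof -
  have "7 * (u / 4) \<le> edge_density * real k"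
    using edge_density_ge(1) by simp
  then obtain I where I: "light_class E S I"
    "real (edge_count E S) \<le> edge_density * real (card S) \<Longrightarrow>
      real (edge_count E (S - I)) \<le> edge_density * (real (card S) - real k)"
    using light_class_step[OF _ S(2) _ _ edge_density_nonneg, of E "u / 4"] S(1)
    by (auto simp: admissible_def)
  obtain q where "colourable I (G \<union> E) q"
    "real q + surplus (real (card S) - real k) \<le> 1 + surplus (real (card S))"
    using light_class_colourable[OF S(1) _ I(1)] S(2) s_ge by fastforce
  then show ?thesis
    using k_ge_2 by (intro that[OF I(1) admissible_Diff[OF S(1) I]])
      (auto simp: colour_bound_def diff_divide_distrib)
qed

lemma greedy_colouring:
  assumes "admissible S"
  shows "\<exists>q. colourable S (G \<union> E) q \<and> real q \<le> colour_bound (real (card S))"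
  using assms
proof (induction "card S" arbitrary: S rule: less_induct)
  case less
  have SV: "S \<subseteq> V"
    using less.prems by (simp add: admissible_def)
  show ?case
  proof (cases "real (card S) < s")
    case True
    from small_set_colourable[OF SV True] colour_bound_ge[OF of_nat_0_le_iff] show ?thesis
      by blast
  next
    case False
    then have large: "s \<le> real (card S)"
      by simp
    obtain I r where I: "light_class E S I" "admissible (S - I)"
      and r: "colourable I (G \<union> E) r"
        "real r + colour_bound (real (card S) - real k) \<le> colour_bound (real (card S))"
      using greedy_step[OF less.prems large] by blast
    note I' = light_classD[OF I(1)]
    have card_Diff: "card (S - I) = card S - k" "k \<le> card S"
      using I'(1-3) large s_ge by (auto simp: card_Diff_subset)
    then obtain q where q: "colourable (S - I) (G \<union> E) q"
      "real q \<le> colour_bound (real (card S) - real k)"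
      using less.hyps[of "S - I"] I(2) k_ge_2 by (auto simp: of_nat_diff)
    have "colourable S (G \<union> E) (q + r)"
      using colourable_Un[OF q(1) r(1)] I'(1) by (simp add: Un_absorb2)
    moreover have "real (q + r) \<le> colour_bound (real (card S))"
      using q(2) r(2) by simp
    ultimately show ?thesis
      by blast
  qed
qed

definition high_degree :: "'a set" where
  "high_degree = {v \<in> V. u / 4 < real (degree_in E V v)}"

lemma finite_high_degree: "finite high_degree"
  using finite_V by (simp add: high_degree_def)

lemma card_high_degree_le: "real (card high_degree) \<le> 8 * u"
proof -
  have "u / 4 * real (card high_degree) = (\<Sum>v\<in>high_degree. u / 4)"
    by simp
  also have "\<dots> \<le> (\<Sum>v\<in>high_degree. real (degree_in E V v))"
    by (rule sum_mono) (simp add: high_degree_def)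
  also have "\<dots> \<le> (\<Sum>v\<in>V. real (degree_in E V v))"
    using finite_V by (intro sum_mono2) (auto simp: high_degree_def)
  also have "\<dots> = 2 * real (card E)"
    using handshake[OF finite_V, of E]
    by (simp add: edge_count_eq_card[OF E_subset] flip: of_nat_sum)
  also have "\<dots> \<le> u / 4 * (8 * u)"
    using card_E by (simp add: power2_eq_square)
  finally show ?thesis
    using u_ge_1 by (subst (asm) mult_le_cancel_left_pos) auto
qed

lemma admissible_low_degree: "admissible (V - high_degree)"
proof -
  have "real (card V) / 2 \<le> real (card (V - high_degree))"
    using card_high_degree_le u_le finite_high_degree card_mono[OF finite_V, of high_degree]
    by (simp add: card_Diff_subset of_nat_diff high_degree_def)
  then have "u\<^sup>2 \<le> edge_density * real (card (V - high_degree))"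
    using edge_density_ge(2) mult_left_mono[OF _ edge_density_nonneg] by fastforce
  then have "real (edge_count E (V - high_degree)) \<le> edge_density * real (card (V - high_degree))"
    using edge_count_le[OF Diff_subset, of high_degree] by linarith
  moreover have "real (degree_in E (V - high_degree) v) \<le> u / 4" if "v \<in> V - high_degree" for v
    using that degree_in_mono[OF finite_V Diff_subset, of E high_degree v]
    by (auto simp: high_degree_def)
  ultimately show ?thesis
    by (auto simp: admissible_def)
qed

lemma chromatic_number_Un_le:
  "real (chromatic_number V (G \<union> E)) \<le> real (card V) / real k + 28 * u + 2 * a + 1"
proof -
  define S where "S = V - high_degree"
  obtain q where q: "colourable S (G \<union> E) q" "real q \<le> colour_bound (real (card S))"
    using greedy_colouring[OF admissible_low_degree] unfolding S_def by blast
  have card_S: "real (card S) \<le> real (card V)"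
    using finite_V by (simp add: S_def card_mono)
  have "colourable (high_degree \<union> S) (G \<union> E) (card high_degree + q)"
    by (intro colourable_Un colourable_card finite_high_degree no_loops q)
  moreover have "high_degree \<union> S = V"
    by (auto simp: S_def high_degree_def)
  ultimately have "chromatic_number V (G \<union> E) \<le> card high_degree + q"
    using chromatic_number_le by metis
  then have "real (chromatic_number V (G \<union> E)) \<le> real (card high_degree) + real q"
    by linarith
  moreover have "real (card S) / real k \<le> real (card V) / real k"
    using card_S by (rule divide_right_mono) simp
  moreover have "surplus (real (card S)) \<le> surplus (real (card V))"
    unfolding surplus_def using edge_density_nonneg card_S
    by (intro mult_left_mono real_sqrt_le_mono) auto
  ultimately show ?thesis
    using card_high_degree_le q(2) surplus_card_V_le u_ge_1 unfolding colour_bound_def by linarith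
qed

end

section \<open>Bounding the overlap sum\<close>

lemma power_minus_one_le:
  fixes b :: real
  assumes "b \<ge> 1"
  shows "b ^ N - 1 \<le> real N * (b - 1) * b ^ (N - 1)"
proof (cases N)
  case (Suc M)
  have "b ^ N - 1 = (b - 1) * (\<Sum>i<N. b ^ i)"
    by (rule power_diff_1_eq)
  also have "\<dots> \<le> (b - 1) * (\<Sum>i<N. b ^ (N - 1))"
    using assms by (intro mult_left_mono sum_mono power_increasing) auto
  finally show ?thesis
    by (simp add: mult_ac)
qed simp

lemma power_le_exp_fact: "real j ^ j \<le> exp (real j) * fact j"
proof -
  have "(\<Sum>i\<in>{j}. real j ^ i /\<^sub>R fact i) \<le> (\<Sum>i. real j ^ i /\<^sub>R fact i)"
    by (rule sum_le_suminf[OF summable_exp_generic]) auto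
  then show ?thesis
    by (simp add: exp_def divide_inverse[symmetric] mult.commute[of "inverse _"] divide_le_eq)
qed

lemma binomial_le_exp_power:
  assumes "j > 0"
  shows "real (n choose j) \<le> (exp 1 * real n / real j) ^ j"
proof -
  have "real (n choose j) * fact j \<le> real n ^ j"
    using binomial_fact_pow[of n j] by (metis of_nat_fact of_nat_le_iff of_nat_mult of_nat_power)
  then have "real (n choose j) * fact j * real j ^ j \<le> real n ^ j * (exp (real j) * fact j)"
    by (intro mult_mono power_le_exp_fact) auto
  then have "real (n choose j) * real j ^ j \<le> real n ^ j * exp (real j)"
    by (simp add: mult_ac)
  also have "exp (real j) = exp 1 ^ j"
    by (simp add: exp_of_nat_mult[symmetric])
  finally show ?thesis
    using assms by (simp add: power_divide power_mult_distrib le_divide_eq mult_ac)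
qed

lemma choose_two_shift: "2 * ((j + 2 choose 2) - 1) = j * (j + 3)"
proof -
  have "even ((j + 2) * (j + 1))"
    by simp
  then have "2 * (j + 2 choose 2) = (j + 2) * (j + 1)"
    by (simp add: choose_two)
  then show ?thesis
    by (simp add: algebra_simps)
qed

lemma Suc_squared_le_power_4: "(Suc i)\<^sup>2 \<le> 4 ^ i"
proof -
  have "(Suc i)\<^sup>2 \<le> (2 ^ i :: nat)\<^sup>2"
    by (intro power_mono) (simp_all add: Suc_leI)
  also have "(2 ^ i :: nat)\<^sup>2 = 4 ^ i"
    by (simp add: power2_eq_square flip: power_mult_distrib)
  finally show ?thesis .
qed

lemma power_choose_two_minus_one_le:
  fixes b h :: real
  assumes b: "1 \<le> b" "b \<le> 2" and h: "sqrt b ^ (i + 5) \<le> h"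
  shows "b ^ ((Suc i + 2 choose 2) - 1) - 1 \<le> 4 * (b - 1) * (4 * h) ^ i"
proof -
  define N where "N = (Suc i + 2 choose 2) - 1"
  have N: "2 * N = Suc i * (i + 4)"
    unfolding N_def choose_two_shift by simp
  then have "N \<le> 2 * (Suc i)\<^sup>2"
    by (simp add: power2_eq_square algebra_simps)
  also have "\<dots> \<le> 2 * 4 ^ i"
    using Suc_squared_le_power_4[of i] by simp
  finally have "real N \<le> real (2 * 4 ^ i)"
    by (rule of_nat_mono)
  then have N_le: "real N \<le> 2 * 4 ^ i"
    by simp
  have "b ^ (N - 1) = sqrt b ^ (2 * (N - 1))"
    using b by (simp add: power_mult)
  also have "2 * (N - 1) = 2 + (i + 5) * i"
    using N by (simp add: algebra_simps)
  also have "sqrt b ^ \<dots> = b * (sqrt b ^ (i + 5)) ^ i"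
    using b by (simp add: power_add power_mult)
  also have "\<dots> \<le> 2 * h ^ i"
    using b h by (intro mult_mono power_mono) auto
  finally have "real N * (b - 1) * b ^ (N - 1) \<le> 2 * 4 ^ i * (b - 1) * (2 * h ^ i)"
    using b N_le by (intro mult_mono) auto
  also have "\<dots> = 4 * (b - 1) * (4 * h) ^ i"
    by (simp add: power_mult_distrib)
  finally show ?thesis
    using power_minus_one_le[OF b(1), of N] unfolding N_def by (rule order_trans[rotated])
qed

lemma binomial_mult_power_le:
  "real ((k - 2) choose j) * (real k / real m) ^ j \<le> ((real k)\<^sup>2 / real m) ^ j"
proof -
  have "(k - 2) choose j \<le> ((k - 2) choose j) * fact j"
    by simp
  also have "\<dots> \<le> (k - 2) ^ j"
    by (rule binomial_fact_pow)
  also have "\<dots> \<le> k ^ j"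
    by (intro power_mono) auto
  finally have "real ((k - 2) choose j) \<le> real (k ^ j)"
    by (rule of_nat_mono)
  then have "real ((k - 2) choose j) * (real k / real m) ^ j \<le> real k ^ j * (real k / real m) ^ j"
    by (intro mult_right_mono) auto
  also have "\<dots> = ((real k)\<^sup>2 / real m) ^ j"
    by (simp add: power2_eq_square power_mult_distrib power_divide)
  finally show ?thesis .
qed

lemma small_overlap_term_le:
  fixes b h :: real
  assumes b: "1 \<le> b" "b \<le> 2" and h: "sqrt b ^ (j + 4) \<le> h" "8 * ((real k)\<^sup>2 / real m) * h \<le> 1"
  shows "overlap_term k m b j \<le> 8 * (b - 1) * ((real k)\<^sup>2 / real m) * (1 / 2) ^ j"
proof (cases j)
  case 0
  then show ?thesis
    using b by (simp add: overlap_term_def numeral_2_eq_2)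
next
  case (Suc i)
  define r where "r = (real k)\<^sup>2 / real m"
  have h0: "0 \<le> h"
    using h(1) b(1) by (auto intro: order_trans[rotated])
  have choose_le: "real ((k - 2) choose j) * (real k / real m) ^ j \<le> r * r ^ i"
    using binomial_mult_power_le[of k j m] by (simp only: r_def Suc power_Suc)
  have "sqrt b ^ (i + 5) \<le> h"
    using h(1) by (simp add: Suc add.commute)
  then have "b ^ ((j + 2 choose 2) - 1) - 1 \<le> 4 * (b - 1) * (4 * h) ^ i"
    unfolding Suc by (rule power_choose_two_minus_one_le[OF b])
  with choose_le have "overlap_term k m b j \<le> r * r ^ i * (4 * (b - 1) * (4 * h) ^ i)"
    unfolding overlap_term_def by (rule mult_mono) (use b in \<open>auto simp: r_def one_le_power\<close>)
  also have "\<dots> = 4 * (b - 1) * r * (4 * r * h) ^ i"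
    by (simp add: power_mult_distrib)
  also have "\<dots> \<le> 4 * (b - 1) * r * (1 / 2) ^ i"
    using h(2) h0 b by (intro mult_left_mono power_mono) (auto simp: r_def)
  also have "\<dots> = 8 * (b - 1) * r * (1 / 2) ^ j"
    by (simp add: Suc algebra_simps)
  finally show ?thesis
    by (simp only: r_def)
qed

lemma large_overlap_term_le:
  fixes b R :: real
  assumes b: "1 \<le> b" and j: "J < j" "j \<le> k - 2"
    and R: "exp 1 * real k / real (J + 1) * (real k / real m) * sqrt b ^ (k + 1) \<le> R"
  shows "overlap_term k m b j \<le> R ^ j"
proof -
  have "real ((k - 2) choose j) \<le> (exp 1 * real (k - 2) / real j) ^ j"
    using j by (intro binomial_le_exp_power) simp
  also have "\<dots> \<le> (exp 1 * real k / real (J + 1)) ^ j"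
    using j by (intro power_mono frac_le mult_left_mono) auto
  finally have choose_le: "real ((k - 2) choose j) \<le> (exp 1 * real k / real (J + 1)) ^ j" .
  have "b ^ ((j + 2 choose 2) - 1) = sqrt b ^ (2 * ((j + 2 choose 2) - 1))"
    using b by (simp add: power_mult)
  also have "\<dots> = (sqrt b ^ (j + 3)) ^ j"
    unfolding choose_two_shift by (simp add: power_mult[symmetric] mult.commute)
  also have "\<dots> \<le> (sqrt b ^ (k + 1)) ^ j"
    using j b by (intro power_mono power_increasing) auto
  finally have "overlap_term k m b j \<le>
      (exp 1 * real k / real (J + 1)) ^ j * (real k / real m) ^ j * (sqrt b ^ (k + 1)) ^ j"
    unfolding overlap_term_def using choose_le b by (intro mult_mono) (auto simp: one_le_power)
  also have "\<dots> = (exp 1 * real k / real (J + 1) * (real k / real m) * sqrt b ^ (k + 1)) ^ j"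
    by (simp only: power_mult_distrib)
  also have "\<dots> \<le> R ^ j"
    using R b by (intro power_mono) auto
  finally show ?thesis .
qed

lemma overlap_sum_le:
  fixes b h R :: real
  assumes b: "1 \<le> b" "b \<le> 2" and k: "2 \<le> k"
    and h: "\<And>j. j \<le> J \<Longrightarrow> sqrt b ^ (j + 4) \<le> h" "8 * ((real k)\<^sup>2 / real m) * h \<le> 1"
    and R: "exp 1 * real k / real (J + 1) * (real k / real m) * sqrt b ^ (k + 1) \<le> R" "R \<le> 1"
  shows "overlap_sum k m b \<le> 16 * (b - 1) * ((real k)\<^sup>2 / real m) + real k * R ^ (J + 1)"
proof -
  define r where "r = (real k)\<^sup>2 / real m"
  have R0: "0 \<le> R"
    using R(1) b by (auto intro: order_trans[rotated])
  have r0: "0 \<le> 8 * (b - 1) * r"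
    using b by (simp add: r_def)
  have "overlap_sum k m b \<le> (\<Sum>j\<le>k - 2. 8 * (b - 1) * r * (1 / 2) ^ j + R ^ (J + 1))"
    unfolding overlap_sum_def
  proof (rule sum_mono)
    fix j assume j: "j \<in> {..k - 2}"
    show "overlap_term k m b j \<le> 8 * (b - 1) * r * (1 / 2) ^ j + R ^ (J + 1)"
    proof (cases "j \<le> J")
      case True
      then show ?thesis
        using small_overlap_term_le[OF b h(1) h(2)] R0 by (simp add: r_def add_increasing2)
    next
      case False
      then have "overlap_term k m b j \<le> R ^ j"
        using j by (intro large_overlap_term_le[OF b(1) _ _ R(1)]) auto
      also have "\<dots> \<le> R ^ (J + 1)"
        using False R0 R(2) by (intro power_decreasing) auto
      finally show ?thesis
        using r0 by (simp add: add_increasing)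
    qed
  qed
  also have "\<dots> = 8 * (b - 1) * r * (\<Sum>j\<le>k - 2. (1 / 2) ^ j) + real (k - 1) * R ^ (J + 1)"
    using k by (simp add: sum.distrib sum_distrib_left Suc_diff_le numeral_2_eq_2)
  also have "\<dots> \<le> 8 * (b - 1) * r * 2 + real k * R ^ (J + 1)"
    using r0 R0 by (intro add_mono mult_left_mono mult_right_mono) (auto simp: sum_gp0)
  finally show ?thesis
    by (simp add: r_def algebra_simps)
qed

section \<open>The random graph for large \<open>n\<close>\<close>

lemma ln_inverse_one_minus_bounds:
  fixes p :: real
  assumes "0 < p" "p \<le> 1 / 2"
  shows "p \<le> ln (1 / (1 - p))" "ln (1 / (1 - p)) \<le> 2 * p"
proof -
  have "ln (1 - p) \<le> (1 - p) - 1"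
    using assms by (intro ln_le_minus_one) auto
  then show "p \<le> ln (1 / (1 - p))"
    using assms by (simp add: ln_div)
  have "ln (1 / (1 - p)) \<le> 1 / (1 - p) - 1"
    using assms by (intro ln_le_minus_one) auto
  also have "\<dots> = 1 / (1 - p) * p"
    using assms by (simp add: field_simps)
  also have "\<dots> \<le> 2 * p"
    using assms by (intro mult_right_mono) (auto simp: field_simps)
  finally show "ln (1 / (1 - p)) \<le> 2 * p" .
qed

lemma sqrt_power_eq_exp:
  fixes b :: real
  assumes "0 < b"
  shows "sqrt b ^ i = exp (real i * (ln b / 2))"
proof -
  have "sqrt b = exp (ln b / 2)"
    using assms by (simp add: ln_sqrt[symmetric])
  then show ?thesis
    by (simp add: exp_of_nat_mult[symmetric])
qed

text \<open>\<open>100352 = 2\<^sup>4 * 6272\<close>, as the class size is at most \<open>2 ln n / p\<close>.\<close>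

definition failure_bound :: "real \<Rightarrow> nat \<Rightarrow> real" where
  "failure_bound \<delta> n =
     2 ^ n * real (n + 1) ^ n * exp (- (real n powr (1 + 3 * \<delta>) / (100352 * ln (real n) ^ 8)))
     + (exp (real n * exp (- (real n powr (2 / 3) / (ln (real n))\<^sup>2))) - 1)"

lemma failure_bound_tendsto_0:
  assumes "\<delta> > 0"
  shows "failure_bound \<delta> \<longlonglongrightarrow> 0"
proof -
  have "(2 :: real) ^ n * real (n + 1) ^ n = exp (real n * ln 2 + real n * ln (real n + 1))" for n
    by (simp add: exp_add exp_of_nat_mult add.commute)
  then have "failure_bound \<delta> = (\<lambda>n. exp (real n * ln 2 + real n * ln (real n + 1)) *
      exp (- (real n powr (1 + 3 * \<delta>) / (100352 * ln (real n) ^ 8))) +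
      (exp (real n * exp (- (real n powr (2 / 3) / (ln (real n))\<^sup>2))) - 1))"
    by (simp add: failure_bound_def fun_eq_iff)
  also have "\<dots> \<longlonglongrightarrow> 0"
    using assms by real_asymp
  finally show ?thesis .
qed

definition margin :: "real \<Rightarrow> real" where
  "margin \<epsilon> = min \<epsilon> 1 / 200"

locale large_gnp =
  fixes \<epsilon> \<delta> p :: real and n :: nat
  assumes \<epsilon>_pos: "0 < \<epsilon>" and \<delta>_pos: "0 < \<delta>" and n_ge_1: "1 \<le> n"
    and p_ge: "real n powr (- 1 / 3 + \<delta>) \<le> p" and p_le: "p \<le> 1 / 2"
    and ln_n_ge: "1000 \<le> ln (real n)" "256 / \<epsilon> \<le> ln (real n)" "3 * \<epsilon> \<le> ln (real n)"
      "3 / margin \<epsilon> \<le> ln (real n)"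
    and ln_n_le: "80 * ln (real n) ^ 3 \<le> real n powr (2 / 3)"
      "64 * ln (real n) \<le> \<epsilon> * real n powr (2 / 3)"
      "32 * ln (real n) ^ 4 \<le> real n powr (1 / 4)"
      "10240 * ln (real n) ^ 6 \<le> real n powr (3 * \<delta>)"
      "168 * ln (real n) ^ 3 \<le> real n powr (margin \<epsilon> / 6)"
      "20 * real n ^ 3 \<le> real n powr (margin \<epsilon> / 2 * (ln (real n) / 7))"

lemma eventually_large_gnp:
  assumes "0 < \<epsilon>" "0 < \<delta>"
    and "\<forall>\<^sub>F n in sequentially. real n powr (- 1 / 3 + \<delta>) \<le> p n \<and> p n \<le> 1 / 2"
  shows "\<forall>\<^sub>F n in sequentially. large_gnp \<epsilon> \<delta> (p n) n"
proof -
  have "0 < margin \<epsilon>"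
    using assms(1) by (simp add: margin_def)
  then have "\<forall>\<^sub>F n in sequentially. 168 * ln (real n) ^ 3 \<le> real n powr (margin \<epsilon> / 6)"
    "\<forall>\<^sub>F n in sequentially. 20 * real n ^ 3 \<le> real n powr (margin \<epsilon> / 2 * (ln (real n) / 7))"
    by real_asymp+
  moreover have "\<forall>\<^sub>F n in sequentially. 10240 * ln (real n) ^ 6 \<le> real n powr (3 * \<delta>)"
    "\<forall>\<^sub>F n in sequentially. 64 * ln (real n) \<le> \<epsilon> * real n powr (2 / 3)"
    using assms(1,2) by real_asymp+
  moreover have "\<forall>\<^sub>F n in sequentially. 80 * ln (real n) ^ 3 \<le> real n powr (2 / 3)"
    "\<forall>\<^sub>F n in sequentially. 32 * ln (real n) ^ 4 \<le> real n powr (1 / 4)"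
    by real_asymp+
  moreover have "\<forall>\<^sub>F n in sequentially. c \<le> ln (real n)" for c
    by real_asymp
  note this[of 1000] this[of "256 / \<epsilon>"] this[of "3 * \<epsilon>"] this[of "3 / margin \<epsilon>"]
  moreover have "\<forall>\<^sub>F n in sequentially. 1 \<le> (n :: nat)"
    by (rule eventually_ge_at_top)
  ultimately show ?thesis
    using assms(3) by eventually_elim (unfold_locales, use assms(1,2) in auto)
qed

context large_gnp
begin

abbreviation L :: real where
  "L \<equiv> ln (real n)"

abbreviation \<eta> :: real where
  "\<eta> \<equiv> margin \<epsilon>"

abbreviation b :: real where
  "b \<equiv> 1 / (1 - p)"

definition \<Lambda> :: real where
  "\<Lambda> = log b (real n * p)"

definition class_size :: nat where
  "class_size = nat \<lfloor>2 * (1 - \<eta>) * \<Lambda>\<rfloor>"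

definition remainder_size :: real where
  "remainder_size = real n / L\<^sup>2"

definition local_density :: real where
  "local_density = 2 * (real n * p / L\<^sup>2)"

lemma n_pos: "0 < real n"
  using n_ge_1 by simp

lemma L_pos: "0 < L"
  using ln_n_ge(1) by linarith

lemma \<eta>_bounds: "0 < \<eta>" "\<eta> \<le> 1 / 200"
  using \<epsilon>_pos by (auto simp: margin_def)

lemma p_pos: "0 < p"
proof -
  have "0 < real n powr (- 1 / 3 + \<delta>)"
    using n_pos by simp
  then show ?thesis
    using p_ge by linarith
qed

sublocale gnp "{1..n}" p
  using p_pos p_le by unfold_locales auto

lemma p_ge_powr: "real n powr (- 1 / 3) \<le> p"
proof -
  have "real n powr (- 1 / 3) \<le> real n powr (- 1 / 3 + \<delta>)"
    using n_ge_1 \<delta>_pos by (intro powr_mono) auto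
  then show ?thesis
    using p_ge by linarith
qed

lemma np_ge_powr: "real n powr (2 / 3) \<le> real n * p"
proof -
  have "real n powr (2 / 3) = real n * real n powr (- 1 / 3)"
    using powr_add[of "real n" 1 "- 1 / 3"] by simp
  also have "\<dots> \<le> real n * p"
    using p_ge_powr by (intro mult_left_mono) auto
  finally show ?thesis .
qed

lemma np_squared_ge_powr: "real n powr (1 / 3) \<le> real n * p\<^sup>2"
proof -
  have "real n powr (1 / 3) = real n * real n powr (- 2 / 3)"
    using powr_add[of "real n" 1 "- 2 / 3"] by simp
  also have "real n powr (- 2 / 3) = (real n powr (- 1 / 3))\<^sup>2"
    using n_pos by (simp add: powr_power)
  also have "real n * \<dots> \<le> real n * p\<^sup>2"
    using p_ge_powr by (intro mult_left_mono power_mono) auto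
  finally show ?thesis .
qed

lemma np_cubed_ge_powr: "real n powr (3 * \<delta>) \<le> real n * p ^ 3"
proof -
  have "real n powr (3 * \<delta>) = real n * (real n powr (- 1 / 3 + \<delta>)) powr 3"
    using powr_add[of "real n" 1 "3 * \<delta> - 1"] by (simp add: powr_powr algebra_simps)
  also have "\<dots> = real n * (real n powr (- 1 / 3 + \<delta>)) ^ 3"
    using n_pos by (simp add: powr_numeral)
  also have "\<dots> \<le> real n * p ^ 3"
    using p_ge by (intro mult_left_mono power_mono) auto
  finally show ?thesis .
qed

lemma ln_np_bounds: "2 / 3 * L \<le> ln (real n * p)" "ln (real n * p) \<le> L"
proof -
  have "ln (real n powr (2 / 3)) \<le> ln (real n * p)"
    using np_ge_powr n_pos p_pos by (subst ln_le_cancel_iff) auto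
  then show "2 / 3 * L \<le> ln (real n * p)"
    using n_pos by (simp add: ln_powr)
  have "real n * p \<le> real n"
    using p_le p_pos by (simp add: mult_left_le)
  then show "ln (real n * p) \<le> L"
    using n_pos p_pos by simp
qed

lemma ln_b_bounds: "p \<le> ln b" "ln b \<le> 2 * p" "0 < ln b"
  using ln_inverse_one_minus_bounds[OF p_pos p_le] p_pos by simp_all

lemma b_bounds: "0 < b" "1 \<le> b" "b \<le> 2" "b - 1 \<le> 2 * p"
  using p_pos p_le by (auto simp: field_simps)

lemma \<Lambda>_eq: "\<Lambda> = ln (real n * p) / ln b"
  by (simp add: \<Lambda>_def log_def)

lemma \<Lambda>_le: "\<Lambda> \<le> L / p"
  unfolding \<Lambda>_eq using ln_np_bounds ln_b_bounds p_pos ln_n_ge by (intro frac_le) auto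

lemma \<Lambda>_ge: "L / (3 * p) \<le> \<Lambda>"
proof -
  have "2 / 3 * L / (2 * p) \<le> \<Lambda>"
    unfolding \<Lambda>_eq using ln_np_bounds ln_b_bounds ln_n_ge by (intro frac_le) auto
  then show ?thesis by simp
qed

lemma \<Lambda>_ge_ln: "2 / 3 * L \<le> \<Lambda>"
proof -
  have "2 / 3 * L \<le> L / (3 * p)"
    using p_le p_pos ln_n_ge by (simp add: le_divide_eq)
  then show ?thesis
    using \<Lambda>_ge by linarith
qed

lemma \<Lambda>_pos: "0 < \<Lambda>"
  using \<Lambda>_ge_ln ln_n_ge by linarith

lemma class_size_le: "real class_size \<le> 2 * (1 - \<eta>) * \<Lambda>"
  and class_size_ge: "2 * (1 - 2 * \<eta>) * \<Lambda> \<le> real class_size"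
proof -
  have "0 \<le> 2 * (1 - \<eta>) * \<Lambda>"
    using \<eta>_bounds \<Lambda>_pos by simp
  then show "real class_size \<le> 2 * (1 - \<eta>) * \<Lambda>"
    unfolding class_size_def by linarith
  have "\<eta> * (2 / 3 * (3 / \<eta>)) \<le> \<eta> * \<Lambda>"
    using \<Lambda>_ge_ln ln_n_ge \<eta>_bounds by (intro mult_left_mono) auto
  then have "2 * (1 - 2 * \<eta>) * \<Lambda> \<le> 2 * (1 - \<eta>) * \<Lambda> - 1"
    using \<eta>_bounds by (simp add: algebra_simps)
  also have "\<dots> \<le> real class_size"
    using \<open>0 \<le> 2 * (1 - \<eta>) * \<Lambda>\<close> unfolding class_size_def by linarith
  finally show "2 * (1 - 2 * \<eta>) * \<Lambda> \<le> real class_size" .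
qed

lemma class_size_ge_\<Lambda>: "\<Lambda> \<le> real class_size"
proof -
  have "1 * \<Lambda> \<le> 2 * (1 - 2 * \<eta>) * \<Lambda>"
    using \<eta>_bounds \<Lambda>_pos by (intro mult_right_mono) auto
  then show ?thesis
    using class_size_ge by linarith
qed

lemma class_size_ge_2: "2 \<le> class_size"
  using class_size_ge_\<Lambda> \<Lambda>_ge_ln ln_n_ge by linarith

lemma class_size_le_\<Lambda>: "real class_size \<le> 2 * \<Lambda>"
proof -
  have "2 * (1 - \<eta>) * \<Lambda> \<le> 2 * \<Lambda>"
    using \<eta>_bounds \<Lambda>_pos by simp
  then show ?thesis
    using class_size_le by linarith
qed

lemma class_size_le_ln: "real class_size \<le> 2 * L / p"
  using class_size_le_\<Lambda> \<Lambda>_le by simp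

lemma class_size_squared_p_ge_1: "1 \<le> (real class_size)\<^sup>2 * p"
proof -
  have "1 * 1 \<le> L * (L / (9 * p))"
    using ln_n_ge p_le p_pos by (intro mult_mono) (auto simp: le_divide_eq)
  also have "\<dots> = (L / (3 * p))\<^sup>2 * p"
    using p_pos by (simp add: power2_eq_square field_simps)
  also have "\<dots> \<le> (real class_size)\<^sup>2 * p"
    using class_size_ge_\<Lambda> \<Lambda>_ge p_pos ln_n_ge by (intro mult_right_mono power_mono) auto
  finally show ?thesis by simp
qed

lemma class_size_le_remainder: "40 * real class_size \<le> remainder_size"
proof -
  have "80 * L ^ 3 \<le> real n * p"
    using np_ge_powr ln_n_le(1) by linarith
  then have "80 * L / p \<le> remainder_size"
    unfolding remainder_size_def using ln_n_ge(1) p_pos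
    by (simp add: divide_simps power2_eq_square power3_eq_cube mult_ac)
  then show ?thesis
    using class_size_le_ln by simp
qed

lemma remainder_size_le: "remainder_size \<le> real n"
proof -
  have "1 \<le> L\<^sup>2"
    using ln_n_ge by (intro one_le_power) auto
  then show ?thesis
    unfolding remainder_size_def by (simp add: divide_le_eq mult_le_cancel_left1)
qed

lemma class_size_le_n: "class_size \<le> n"
  using class_size_le_remainder remainder_size_le by linarith

lemma inverse_le_remainder:
  assumes "remainder_size \<le> m"
  shows "1 / m \<le> L\<^sup>2 / real n"
proof -
  have pos: "0 < remainder_size"
    unfolding remainder_size_def by (intro divide_pos_pos n_pos zero_less_power L_pos)
  then have "1 / m \<le> 1 / remainder_size"
    using assms by (intro divide_left_mono mult_pos_pos) auto
  then show ?thesis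
    by (simp add: remainder_size_def)
qed

text \<open>Overlaps of size below \<open>L / (7 ln b)\<close> contribute like a geometric series with the
  first term dominating, larger ones a negligible amount.\<close>

definition overlap_cutoff :: nat where
  "overlap_cutoff = nat \<lfloor>L / ln b / 7\<rfloor>"

lemma ln_div_ln_b_ge: "L \<le> L / ln b"
proof -
  have "ln b \<le> 1"
    using ln_b_bounds p_le by linarith
  then show ?thesis
    using ln_n_ge ln_b_bounds by (simp add: le_divide_eq mult_left_le)
qed

lemma overlap_cutoff_bounds:
  "real overlap_cutoff + 4 \<le> L / ln b / 6" "L / ln b / 7 \<le> real (overlap_cutoff + 1)"
proof -
  define x where "x = L / ln b"
  have "1000 \<le> x"
    using ln_div_ln_b_ge ln_n_ge(1) unfolding x_def by linarith
  then show "real overlap_cutoff + 4 \<le> L / ln b / 6" "L / ln b / 7 \<le> real (overlap_cutoff + 1)"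
    unfolding overlap_cutoff_def x_def[symmetric] by linarith+
qed

lemma sqrt_b_power_le_below_cutoff:
  assumes "j \<le> overlap_cutoff"
  shows "sqrt b ^ (j + 4) \<le> real n powr (1 / 12)"
proof -
  have "real (j + 4) * (ln b / 2) \<le> L / ln b / 6 * (ln b / 2)"
    using assms overlap_cutoff_bounds(1) ln_b_bounds(3) by (intro mult_right_mono) auto
  also have "\<dots> = 1 / 12 * L"
    using ln_b_bounds(3) by simp
  finally show ?thesis
    unfolding sqrt_power_eq_exp[OF b_bounds(1)] powr_def using n_pos by simp
qed

lemma sqrt_b_power_le_np_powr: "sqrt b ^ (class_size + 1) \<le> 2 * (real n * p) powr (1 - \<eta>)"
proof -
  have "real class_size * (ln b / 2) \<le> 2 * (1 - \<eta>) * \<Lambda> * (ln b / 2)"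
    using class_size_le ln_b_bounds by (intro mult_right_mono) auto
  also have "\<dots> = (1 - \<eta>) * ln (real n * p)"
    using ln_b_bounds(3) by (simp add: \<Lambda>_eq)
  finally have "sqrt b ^ class_size \<le> (real n * p) powr (1 - \<eta>)"
    unfolding sqrt_power_eq_exp[OF b_bounds(1)] powr_def using n_pos p_pos by simp
  moreover have "sqrt b \<le> 2"
    using b_bounds by (intro real_le_lsqrt) auto
  ultimately have "sqrt b * sqrt b ^ class_size \<le> 2 * (real n * p) powr (1 - \<eta>)"
    using b_bounds by (intro mult_mono) auto
  then show ?thesis by simp
qed

lemma class_size_squared_div_le:
  assumes "remainder_size \<le> m"
  shows "8 * ((real class_size)\<^sup>2 / m) * real n powr (1 / 12) \<le> 1"
proof -
  have "(real class_size)\<^sup>2 * (1 / m) \<le> (2 * L / p)\<^sup>2 * (L\<^sup>2 / real n)"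
    using class_size_le_ln inverse_le_remainder[OF assms] assms class_size_le_remainder
    by (intro mult_mono power_mono) auto
  also have "\<dots> = 4 * L ^ 4 / (real n * p\<^sup>2)"
    by (simp add: power_divide power_mult_distrib field_simps eval_nat_numeral)
  also have "\<dots> \<le> 4 * L ^ 4 / real n powr (1 / 3)"
    using np_squared_ge_powr n_pos p_pos by (intro divide_left_mono) auto
  finally have "8 * ((real class_size)\<^sup>2 / m) * real n powr (1 / 12) \<le>
      8 * (4 * L ^ 4 / real n powr (1 / 3)) * real n powr (1 / 12)"
    by (intro mult_right_mono mult_left_mono) auto
  also have "\<dots> = 32 * L ^ 4 / (real n powr (1 / 3) / real n powr (1 / 12))"
    by simp
  also have "real n powr (1 / 3) / real n powr (1 / 12) = real n powr (1 / 4)"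
    by (simp add: powr_diff[symmetric])
  also have "32 * L ^ 4 / \<dots> \<le> 1"
    using ln_n_le(3) n_pos by simp
  finally show ?thesis .
qed

lemma class_size_div_cutoff_le: "exp 1 * real class_size / real (overlap_cutoff + 1) \<le> 42"
proof -
  note class_size_le_\<Lambda>
  also have "2 * \<Lambda> \<le> 2 * (L / ln b)"
    unfolding \<Lambda>_eq using ln_np_bounds ln_b_bounds(3)
    by (intro mult_left_mono divide_right_mono) auto
  also have "\<dots> \<le> 14 * real (overlap_cutoff + 1)"
    using overlap_cutoff_bounds(2) by simp
  finally have "exp 1 * real class_size \<le> 3 * (14 * real (overlap_cutoff + 1))"
    using exp_le by (intro mult_mono) auto
  then show ?thesis
    by (simp add: divide_le_eq)
qed

lemma class_size_div_le:
  assumes "remainder_size \<le> m"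
  shows "real class_size / m \<le> 2 * L ^ 3 / (real n * p)"
proof -
  have "real class_size * (1 / m) \<le> (2 * L / p) * (L\<^sup>2 / real n)"
    using class_size_le_ln inverse_le_remainder[OF assms] assms class_size_le_remainder p_pos
      ln_n_ge(1) by (intro mult_mono) auto
  also have "\<dots> = 2 * L ^ 3 / (real n * p)"
    by (simp add: power2_eq_square power3_eq_cube mult_ac)
  finally show ?thesis by simp
qed

lemma overlap_ratio_le:
  assumes "remainder_size \<le> m"
  shows "exp 1 * real class_size / real (overlap_cutoff + 1) * (real class_size / m) *
    sqrt b ^ (class_size + 1) \<le> real n powr (- \<eta> / 2)"
proof -
  define P where "P = real n * p"
  have P: "0 < P"
    using n_pos p_pos by (simp add: P_def)
  have "exp 1 * real class_size / real (overlap_cutoff + 1) * (real class_size / m) *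
      sqrt b ^ (class_size + 1) \<le> 42 * (2 * L ^ 3 / P) * (2 * P powr (1 - \<eta>))"
    using class_size_div_cutoff_le class_size_div_le[OF assms] sqrt_b_power_le_np_powr b_bounds P
      ln_n_ge(1) assms class_size_le_remainder unfolding P_def by (intro mult_mono) auto
  also have "\<dots> = 168 * L ^ 3 * P powr (- \<eta>)"
    using P by (simp add: powr_diff powr_minus field_simps)
  also have "\<dots> \<le> 168 * L ^ 3 * (real n powr (2 / 3)) powr (- \<eta>)"
    using np_ge_powr \<eta>_bounds n_pos ln_n_ge(1) unfolding P_def
    by (intro mult_left_mono powr_mono2') auto
  also have "\<dots> \<le> real n powr (\<eta> / 6) * (real n powr (2 / 3)) powr (- \<eta>)"
    using ln_n_le(5) by (intro mult_right_mono) auto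
  also have "\<dots> = real n powr (- \<eta> / 2)"
    by (simp add: powr_powr powr_add[symmetric])
  finally show ?thesis .
qed

lemma powr_overlap_cutoff_le:
  "20 * (real class_size ^ 3 * (real n powr (- \<eta> / 2)) ^ (overlap_cutoff + 1)) \<le> 1"
proof -
  have "(real n powr (- \<eta> / 2)) ^ (overlap_cutoff + 1) =
      real n powr (- (\<eta> / 2 * real (overlap_cutoff + 1)))"
    using n_pos by (subst powr_realpow[symmetric]) (simp_all add: powr_powr)
  also have "\<dots> \<le> real n powr (- (\<eta> / 2 * (L / 7)))"
    using overlap_cutoff_bounds(2) ln_div_ln_b_ge \<eta>_bounds n_ge_1
    by (intro powr_mono le_imp_neg_le mult_left_mono) auto
  finally have "real class_size ^ 3 * (real n powr (- \<eta> / 2)) ^ (overlap_cutoff + 1)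
      \<le> real n ^ 3 * real n powr (- (\<eta> / 2 * (L / 7)))"
    using class_size_le_n by (intro mult_mono power_mono) auto
  also have "20 * \<dots> \<le> 1"
    using ln_n_le(6) n_pos by (simp add: powr_minus divide_inverse[symmetric])
  finally show ?thesis by simp
qed

lemma overlap_sum_small:
  assumes m: "remainder_size \<le> real m"
  shows "(real class_size)\<^sup>2 * overlap_sum class_size m b \<le> 1 / 10"
proof -
  let ?k = "real class_size"
  let ?R = "(real n powr (- \<eta> / 2)) ^ (overlap_cutoff + 1)"
  have "?k ^ 4 * (1 / real m) \<le> (2 * L / p) ^ 4 * (L\<^sup>2 / real n)"
    using class_size_le_ln inverse_le_remainder[OF m] by (intro mult_mono power_mono) auto
  then have "32 * p * (?k ^ 4 * (1 / real m)) \<le> 32 * p * ((2 * L / p) ^ 4 * (L\<^sup>2 / real n))"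
    using p_pos by (intro mult_left_mono) auto
  also have "\<dots> = 512 * L ^ 6 / (real n * p ^ 3)"
    using p_pos by (simp add: power_divide power_mult_distrib field_simps eval_nat_numeral)
  also have "\<dots> \<le> 512 * L ^ 6 / real n powr (3 * \<delta>)"
    using np_cubed_ge_powr ln_n_ge(1) n_pos p_pos by (intro divide_left_mono) auto
  also have "\<dots> \<le> 1 / 20"
    using ln_n_le(4) n_pos by (simp add: divide_le_eq)
  finally have small: "32 * p * (?k ^ 4 * (1 / real m)) \<le> 1 / 20" .
  have "overlap_sum class_size m b \<le> 16 * (b - 1) * (?k\<^sup>2 / real m) + ?k * ?R"
  proof (rule overlap_sum_le)
    show "real n powr (- \<eta> / 2) \<le> 1"
      using n_ge_1 \<eta>_bounds powr_mono[of "- \<eta> / 2" 0 "real n"] by simp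
  qed (use b_bounds class_size_ge_2 sqrt_b_power_le_below_cutoff class_size_squared_div_le[OF m]
      overlap_ratio_le[OF m] in auto)
  also have "\<dots> \<le> 16 * (2 * p) * (?k\<^sup>2 / real m) + ?k * ?R"
    using b_bounds(4) by (intro add_right_mono mult_right_mono mult_left_mono) auto
  finally have "?k\<^sup>2 * overlap_sum class_size m b \<le>
      ?k\<^sup>2 * (16 * (2 * p) * (?k\<^sup>2 / real m) + ?k * ?R)"
    by (rule mult_left_mono) simp
  also have "\<dots> = 32 * p * (?k ^ 4 * (1 / real m)) + ?k ^ 3 * ?R"
    by (simp add: algebra_simps eval_nat_numeral)
  finally show ?thesis
    using small powr_overlap_cutoff_le by linarith
qed

lemma prob_not_richly_independent_large_le:
  "prob {G. \<not> richly_independent {1..n} class_size remainder_size G} \<le>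
    2 ^ n * real (n + 1) ^ n * exp (- (real n powr (1 + 3 * \<delta>) / (100352 * L ^ 8)))"
proof -
  have "prob {G. \<not> richly_independent {1..n} class_size remainder_size G} \<le>
      2 ^ n * real (n + 1) ^ n * exp (- (remainder_size\<^sup>2 / (6272 * (real class_size ^ 4 * p))))"
    using prob_not_richly_independent_le[OF class_size_ge_2 p_pos p_le class_size_squared_p_ge_1,
        of remainder_size] class_size_le_remainder overlap_sum_small by simp
  also have "\<dots> \<le> 2 ^ n * real (n + 1) ^ n * exp (- (real n powr (1 + 3 * \<delta>) / (100352 * L ^ 8)))"
  proof -
    have "real n powr (1 + 3 * \<delta>) \<le> real n * (real n * p ^ 3)"
      using np_cubed_ge_powr n_pos by (simp add: powr_add)
    then have "real n powr (1 + 3 * \<delta>) / (100352 * L ^ 8) \<le> (real n)\<^sup>2 * p ^ 3 / (100352 * L ^ 8)"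
      by (intro divide_right_mono) (auto simp: power2_eq_square)
    also have "\<dots> = remainder_size\<^sup>2 / (6272 * ((2 * L / p) ^ 4 * p))"
      unfolding remainder_size_def using p_pos ln_n_ge(1)
      by (simp add: divide_simps) (simp add: eval_nat_numeral)
    also have "\<dots> \<le> remainder_size\<^sup>2 / (6272 * (real class_size ^ 4 * p))"
      using class_size_le_ln class_size_ge_2 p_pos ln_n_ge(1)
      by (intro divide_left_mono mult_left_mono mult_right_mono power_mono) auto
    finally show ?thesis by simp
  qed
  finally show ?thesis .
qed

lemma prob_not_locally_sparse_large_le:
  "prob {G. \<not> locally_sparse {1..n} remainder_size local_density G} \<le>
    exp (real n * exp (- (real n powr (2 / 3) / L\<^sup>2))) - 1"
proof -
  have "prob {G. \<not> locally_sparse {1..n} remainder_size local_density G} \<le>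
      (1 + exp (- local_density / 2)) ^ n - 1"
    using prob_not_locally_sparse_le[of remainder_size local_density]
    by (simp add: remainder_size_def local_density_def mult.commute)
  also have "\<dots> \<le> exp (exp (- local_density / 2)) ^ n - 1"
    by (intro diff_right_mono power_mono) (auto intro: exp_ge_add_one_self add_nonneg_nonneg)
  also have "\<dots> = exp (real n * exp (- local_density / 2)) - 1"
    by (simp add: exp_of_nat_mult)
  also have "\<dots> \<le> exp (real n * exp (- (real n powr (2 / 3) / L\<^sup>2))) - 1"
    using np_ge_powr by (auto simp: local_density_def intro!: mult_left_mono divide_right_mono)
  finally show ?thesis .
qed

definition colour_unit :: real where
  "colour_unit = \<epsilon> * real n / (64 * \<Lambda>)"

lemma colour_unit_bounds:
  "1 \<le> colour_unit" "16 * colour_unit \<le> real n" "2 * local_density \<le> colour_unit"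
proof -
  have "64 * L \<le> \<epsilon> * (real n * p)"
    using ln_n_le(2) mult_left_mono[OF np_ge_powr, of \<epsilon>] \<epsilon>_pos by linarith
  then have "64 * (L / p) \<le> \<epsilon> * real n"
    using p_pos by (simp add: divide_simps mult_ac)
  then have "64 * \<Lambda> \<le> \<epsilon> * real n"
    using \<Lambda>_le by linarith
  then show "1 \<le> colour_unit"
    using \<Lambda>_pos by (simp add: colour_unit_def le_divide_eq)
  have "\<epsilon> * real n \<le> 4 * \<Lambda> * real n"
    using \<Lambda>_ge_ln ln_n_ge by (intro mult_right_mono) auto
  then show "16 * colour_unit \<le> real n"
    using \<Lambda>_pos by (simp add: colour_unit_def divide_le_eq mult_ac)
  have "256 * (real n * p) \<le> \<epsilon> * L * (real n * p)"
    using ln_n_ge(2) \<epsilon>_pos p_pos by (intro mult_right_mono) (auto simp: divide_le_eq mult.commute)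
  then have "2 * local_density \<le> \<epsilon> * real n / (64 * (L / p))"
    unfolding local_density_def using ln_n_ge(1) p_pos
    by (simp add: divide_simps power2_eq_square mult_ac)
  also have "\<dots> \<le> colour_unit"
    unfolding colour_unit_def using \<Lambda>_le \<Lambda>_pos \<epsilon>_pos p_pos ln_n_ge(1)
    by (intro divide_left_mono) auto
  finally show "2 * local_density \<le> colour_unit" .
qed

lemma margin_inverse_le: "1 \<le> (1 + \<epsilon> / 40) * (1 - 2 * \<eta>)"
proof -
  define \<mu> where "\<mu> = min \<epsilon> 1"
  have \<mu>: "0 < \<mu>" "\<mu> \<le> 1" "\<mu> \<le> \<epsilon>"
    using \<epsilon>_pos by (auto simp: \<mu>_def)
  have "\<mu> * \<mu> \<le> \<mu>"
    using \<mu> by (simp add: mult_left_le)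
  then have "1 \<le> (1 + \<mu> / 40) * (1 - \<mu> / 100)"
    using \<mu> by (simp add: algebra_simps)
  also have "\<dots> \<le> (1 + \<epsilon> / 40) * (1 - \<mu> / 100)"
    using \<mu> by (intro mult_right_mono) auto
  finally show ?thesis
    by (simp add: margin_def \<mu>_def)
qed

lemma n_div_class_size_le: "real n / real class_size \<le> real n / (2 * \<Lambda>) + 4 / 5 * colour_unit"
proof -
  have "2 * \<Lambda> * 1 \<le> 2 * \<Lambda> * ((1 + \<epsilon> / 40) * (1 - 2 * \<eta>))"
    using \<Lambda>_pos margin_inverse_le by (intro mult_left_mono) auto
  also have "\<dots> = (1 + \<epsilon> / 40) * (2 * (1 - 2 * \<eta>) * \<Lambda>)"
    by simp
  also have "\<dots> \<le> (1 + \<epsilon> / 40) * real class_size"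
    using class_size_ge \<epsilon>_pos by (intro mult_left_mono) auto
  finally have "real n * (2 * \<Lambda>) \<le> real n * ((1 + \<epsilon> / 40) * real class_size)"
    by (intro mult_left_mono) auto
  then have "real n / real class_size \<le> real n / (2 * \<Lambda>) * (1 + \<epsilon> / 40)"
    using class_size_ge_2 \<Lambda>_pos by (simp add: field_simps)
  also have "\<dots> = real n / (2 * \<Lambda>) + 4 / 5 * colour_unit"
    using \<Lambda>_pos by (simp add: colour_unit_def field_simps)
  finally show ?thesis .
qed

lemma chromatic_number_le_of_pseudorandom:
  assumes G: "G \<subseteq> nsets {1..n} 2" "richly_independent {1..n} class_size remainder_size G"
      "locally_sparse {1..n} remainder_size local_density G"
    and E: "E \<subseteq> nsets {1..n} 2" "real (card E) \<le> 1 / 2 ^ 12 * \<epsilon>\<^sup>2 * ((real n)\<^sup>2 / \<Lambda>\<^sup>2)"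
  shows "real (chromatic_number {1..n} (G \<union> E)) \<le> (1 + \<epsilon>) * (real n / (2 * \<Lambda>))"
proof -
  interpret augmented_pseudorandom_graph "{1..n}" G class_size remainder_size local_density E colour_unit
  proof
    show "0 \<le> local_density"
      using p_pos by (simp add: local_density_def)
    show "real (card E) \<le> colour_unit\<^sup>2"
      using E(2) by (simp add: colour_unit_def power_divide power_mult_distrib)
  qed (use G E class_size_ge_2 class_size_le_remainder colour_unit_bounds in auto)
  have "real (chromatic_number {1..n} (G \<union> E)) \<le>
      real n / real class_size + 28 * colour_unit + 2 * local_density + 1"
    using chromatic_number_Un_le by simp
  also have "\<dots> \<le> real n / (2 * \<Lambda>) + 32 * colour_unit"
    using n_div_class_size_le colour_unit_bounds by linarith
  also have "\<dots> = (1 + \<epsilon>) * (real n / (2 * \<Lambda>))"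
    using \<Lambda>_pos by (simp add: colour_unit_def field_simps)
  finally show ?thesis .
qed

lemma prob_robust_chromatic_number_ge:
  "1 - failure_bound \<delta> n \<le> prob {G. \<forall>E \<subseteq> nsets {1..n} 2.
      real (card E) \<le> 1 / 2 ^ 12 * \<epsilon>\<^sup>2 * ((real n)\<^sup>2 / \<Lambda>\<^sup>2) \<longrightarrow>
      real (chromatic_number {1..n} (G \<union> E)) \<le> (1 + \<epsilon>) * (real n / (2 * \<Lambda>))}"
    (is "_ \<le> prob ?robust")
proof -
  define rich where "rich = {G. richly_independent {1..n} class_size remainder_size G}"
  define sparse where "sparse = {G. locally_sparse {1..n} remainder_size local_density G}"
  have "1 - failure_bound \<delta> n \<le> 1 - (prob (- rich) + prob (- sparse))"
    using prob_not_richly_independent_large_le prob_not_locally_sparse_large_le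
    by (simp add: failure_bound_def rich_def sparse_def Collect_neg_eq)
  also have "\<dots> \<le> 1 - prob (- rich \<union> - sparse)"
    by (intro diff_left_mono measure_Un_le) auto
  also have "\<dots> = prob (rich \<inter> sparse)"
    using measure_pmf.prob_compl[of "rich \<inter> sparse" "random_subset (nsets {1..n} 2) p"]
    by (simp add: Compl_eq_Diff_UNIV[symmetric])
  also have "\<dots> \<le> prob ?robust"
  proof (rule measure_pmf.finite_measure_mono_AE)
    show "AE G in random_subset (nsets {1..n} 2) p. G \<in> rich \<inter> sparse \<longrightarrow> G \<in> ?robust"
    proof (intro AE_pmfI impI CollectI allI)
      fix G E assume "G \<in> set_pmf (random_subset (nsets {1..n} 2) p)" "G \<in> rich \<inter> sparse"
        "E \<subseteq> nsets {1..n} 2" "real (card E) \<le> 1 / 2 ^ 12 * \<epsilon>\<^sup>2 * ((real n)\<^sup>2 / \<Lambda>\<^sup>2)"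
      then show "real (chromatic_number {1..n} (G \<union> E)) \<le> (1 + \<epsilon>) * (real n / (2 * \<Lambda>))"
        by (intro chromatic_number_le_of_pseudorandom)
          (auto simp: rich_def sparse_def dest: random_subset_subset)
    qed
  qed simp
  finally show ?thesis .
qed

end

theorem theorem1p1:
  fixes \<epsilon> \<delta> :: real and p b :: "nat \<Rightarrow> real"
  assumes "\<epsilon> > 0" and "\<delta> > 0"
    and "\<forall>\<^sub>F n in sequentially. real n powr (- 1 / 3 + \<delta>) \<le> p n \<and> p n \<le> 1 / 2"
    and "\<And>n. b n = 1 / (1 - p n)"
  shows "(\<lambda>n. measure_pmf.prob (random_graph n (p n))
            {G. \<forall>E \<subseteq> nsets {1..n} 2.
                  real (card E) \<le> 1 / 2 ^ 12 * \<epsilon>\<^sup>2 * ((real n)\<^sup>2 / (log (b n) (real n * p n))\<^sup>2) \<longrightarrow>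
                  real (chromatic_number {1..n} (G \<union> E))
                    \<le> (1 + \<epsilon>) * (real n / (2 * log (b n) (real n * p n)))})
         \<longlonglongrightarrow> 1"
    (is "?prob \<longlonglongrightarrow> 1")
proof (rule tendsto_sandwich)
  show "\<forall>\<^sub>F n in sequentially. 1 - failure_bound \<delta> n \<le> ?prob n"
    using eventually_large_gnp[OF assms(1-3)]
  proof eventually_elim
    case (elim n)
    then interpret large_gnp \<epsilon> \<delta> "p n" n .
    show ?case
      using prob_robust_chromatic_number_ge unfolding \<Lambda>_def random_graph_eq_random_subset assms(4) .
  qed
  show "(\<lambda>n. 1 - failure_bound \<delta> n) \<longlonglongrightarrow> 1"
    using tendsto_diff[OF tendsto_const failure_bound_tendsto_0[OF assms(2)], of 1] by simp
qed auto

end
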